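(* Let $\alpha,\beta,\delta>0$ and consider on a neighbourhood of the origin of $\mathbb{R}^4$, with canonical coordinates $\boldsymbol{x}=(q_1,q_2,p_1,p_2)^T$, the Hamiltonian $$H=\frac12\left(\frac{p_1^2}{\alpha(\beta^2\cos^2 q_1+\sin^2 q_1)}+p_2^2+(q_2-\beta\sin q_1)^2+(\delta+1-\cos q_1)^2\right).$$ Let $$\omega_{1,2}=\frac{\sqrt2\,\sqrt{(\alpha+1)\beta^2+\delta\pm\sqrt{(\alpha+1)^2\beta^4-2(\alpha-1)\beta^2\delta+\delta^2}}}{2\beta\sqrt{\alpha}},$$ with the sign $+$ for $\omega_1$ and $-$ for $\omega_2$. Assume that $\omega_1,\omega_2$ satisfy no resonance relation of order four or less, i.e. $m\omega_1+n\omega_2\neq0$ for all integers $m,n$ with $0<|m|+|n|\le 4$. Then the Birkhoff normal form of degree four of $H$ at the equilibrium $\boldsymbol{x}=0$ is $$\mathcal{H}_4=\omega_1I_1+\omega_2I_2+h_{20}I_1^2+h_{11}I_1I_2+h_{02}I_2^2,$$ that is, there is a real canonical transformation $\boldsymbol{x}=\boldsymbol{x}(\boldsymbol{X})$, $\boldsymbol{X}=(Q_1,Q_2,P_1,P_2)^T$, analytic near the origin and fixing it, such that $H(\boldsymbol{x}(\boldsymbol{X}))=H(0)+\mathcal{H}_4+O(|\boldsymbol{X}|^5)$ with $I_i=\frac12(Q_i^2+P_i^2)$, where $$h_{20}=\frac{\omega_1^2\omega_2^4(\omega_1^2-1)\left(3\delta(\omega_1^2-1)(\omega_2^2-1)+(3\omega_2^2+1)\omega_1^2-3\omega_2^2+3\right)}{16\delta^2(\omega_1^2-\omega_2^2)^2(\omega_2^2-1)},$$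 $$h_{11}=\frac{\omega_1^3\omega_2^3\left((1-3\omega_2^2)\omega_1^2+\omega_2^2-3-3\delta(\omega_1^2-1)(\omega_2^2-1)\right)}{4\delta^2(\omega_1^2-\omega_2^2)^2},$$ $$h_{02}=\frac{\omega_1^4\omega_2^2(\omega_2^2-1)\left(3\delta(\omega_1^2-1)(\omega_2^2-1)+3(\omega_2^2-1)\omega_1^2+\omega_2^2+3\right)}{16\delta^2(\omega_1^2-1)(\omega_1^2-\omega_2^2)^2}.$$
   Context: "Canonical" means preserving the standard symplectic form: the Jacobian matrix $\boldsymbol{M}$ of the transformation satisfies $\boldsymbol{M}^T\boldsymbol{J}\boldsymbol{M}=\boldsymbol{J}$, with $\boldsymbol{J}=\begin{pmatrix}0&\mathbb{I}_{2\times2}\\-\mathbb{I}_{2\times2}&0\end{pmatrix}$. The variables $I_i$ are the actions of the symplectic polar coordinates $Q_i=\sqrt{2I_i}\sin\phi_i$, $P_i=\sqrt{2I_i}\cos\phi_i$. A Birkhoff normal form of degree $K$ is the transformed Hamiltonian truncated at degree $K$, whose homogeneous terms up to degree $K$ all Poisson commute with the quadratic part $\frac12\omega_1(Q_1^2+P_1^2)+\frac12\omega_2(Q_2^2+P_2^2)$; in the absence of resonances up to order $K$ it is a polynomial in $I_1,I_2$. *)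

theory Defs
  imports "HOL-Analysis.Analysis" "HOL-Library.Landau_Symbols"
begin

text \<open>Phase space is \<open>real^4\<close>: components 1, 2 are the positions and 3, 4 the conjugate momenta.\<close>

definition symplectic_J :: "real^4^4" where
  "symplectic_J = vector [vector [0, 0, 1, 0],
                          vector [0, 0, 0, 1],
                          vector [-1, 0, 0, 0],
                          vector [0, -1, 0, 0]]"

definition real_analytic_at :: "(real^'n \<Rightarrow> real) \<Rightarrow> real^'n \<Rightarrow> bool" where
  "real_analytic_at f a \<longleftrightarrow>
     (\<exists>(c :: ('n \<Rightarrow> nat) \<Rightarrow> real) r. r > 0 \<and>
        (\<forall>v. (\<forall>i. \<bar>v $ i\<bar> < r) \<longrightarrow>
           ((\<lambda>k. c k * (\<Prod>i\<in>UNIV. (v $ i) ^ k i)) has_sum f (a + v)) UNIV))"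

text \<open>Differentiability follows from analyticity; it is listed because \<open>jacobian\<close> is
  meaningful only for differentiable maps. Local invertibility follows from the symplectic
  condition.\<close>

definition analytic_canonical_on :: "(real^4) set \<Rightarrow> (real^4 \<Rightarrow> real^4) \<Rightarrow> bool" where
  "analytic_canonical_on U \<phi> \<longleftrightarrow>
     (\<forall>X\<in>U. (\<forall>i. real_analytic_at (\<lambda>Y. \<phi> Y $ i) X) \<and>
        \<phi> differentiable (at X) \<and>
        transpose (jacobian \<phi> (at X)) ** symplectic_J ** jacobian \<phi> (at X) = symplectic_J)"

definition homogeneous_polynomial :: "nat \<Rightarrow> (real^'n \<Rightarrow> real) \<Rightarrow> bool" where
  "homogeneous_polynomial d f \<longleftrightarrow>
     (\<exists>c :: ('n \<Rightarrow> nat) \<Rightarrow> real. \<forall>x.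
        f x = (\<Sum>k | (\<Sum>i\<in>UNIV. k i) = d. c k * (\<Prod>i\<in>UNIV. (x $ i) ^ k i)))"

definition partial_deriv :: "(real^'n \<Rightarrow> real) \<Rightarrow> 'n \<Rightarrow> real^'n \<Rightarrow> real" where
  "partial_deriv f i x = frechet_derivative f (at x) (axis i 1)"

definition poisson_bracket :: "(real^4 \<Rightarrow> real) \<Rightarrow> (real^4 \<Rightarrow> real) \<Rightarrow> real^4 \<Rightarrow> real" where
  "poisson_bracket f g x =
     partial_deriv f 1 x * partial_deriv g 3 x - partial_deriv f 3 x * partial_deriv g 1 x +
     partial_deriv f 2 x * partial_deriv g 4 x - partial_deriv f 4 x * partial_deriv g 2 x"

definition action1 :: "real^4 \<Rightarrow> real" where
  "action1 X = ((X $ 1)\<^sup>2 + (X $ 3)\<^sup>2) / 2"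

definition action2 :: "real^4 \<Rightarrow> real" where
  "action2 X = ((X $ 2)\<^sup>2 + (X $ 4)\<^sup>2) / 2"

definition quadratic_part :: "real \<Rightarrow> real \<Rightarrow> real^4 \<Rightarrow> real" where
  "quadratic_part \<omega>\<^sub>1 \<omega>\<^sub>2 X =
     \<omega>\<^sub>1 * ((X $ 1)\<^sup>2 + (X $ 3)\<^sup>2) / 2 + \<omega>\<^sub>2 * ((X $ 2)\<^sup>2 + (X $ 4)\<^sup>2) / 2"

text \<open>\<open>N\<close> is a Birkhoff normal form of degree \<open>K\<close> of \<open>H\<close> at the origin, with the constant
  \<open>H 0\<close> left out of \<open>N\<close>; \<open>h k\<close> is its homogeneous term of degree \<open>k\<close>.\<close>

definition birkhoff_normal_form ::
    "nat \<Rightarrow> real \<Rightarrow> real \<Rightarrow> (real^4 \<Rightarrow> real) \<Rightarrow> (real^4 \<Rightarrow> real) \<Rightarrow> bool" where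
  "birkhoff_normal_form K \<omega>\<^sub>1 \<omega>\<^sub>2 H N \<longleftrightarrow>
     (\<exists>h. h 2 = quadratic_part \<omega>\<^sub>1 \<omega>\<^sub>2 \<and>
        (\<forall>k\<in>{1..K}. homogeneous_polynomial k (h k) \<and>
           (\<forall>X. poisson_bracket (h k) (quadratic_part \<omega>\<^sub>1 \<omega>\<^sub>2) X = 0)) \<and>
        (\<forall>X. N X = (\<Sum>k=1..K. h k X))) \<and>
     (\<exists>U \<phi>. open U \<and> 0 \<in> U \<and> \<phi> 0 = 0 \<and> analytic_canonical_on U \<phi> \<and>
        (\<lambda>X. H (\<phi> X) - (H 0 + N X)) \<in> O[at 0](\<lambda>X. norm X ^ (K + 1)))"

definition hamiltonian :: "real \<Rightarrow> real \<Rightarrow> real \<Rightarrow> real^4 \<Rightarrow> real" where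
  "hamiltonian \<alpha> \<beta> \<delta> x =
     ((x $ 3)\<^sup>2 / (\<alpha> * (\<beta>\<^sup>2 * (cos (x $ 1))\<^sup>2 + (sin (x $ 1))\<^sup>2)) + (x $ 4)\<^sup>2 +
      (x $ 2 - \<beta> * sin (x $ 1))\<^sup>2 + (\<delta> + 1 - cos (x $ 1))\<^sup>2) / 2"

end

theory Submission
  imports Defs "HOL-Real_Asymp.Real_Asymp"
begin

text \<open>The Hamiltonian is even, so it has no cubic terms and only its quartic part has to be
  normalised. After a linear symplectic diagonalisation of the quadratic part, a quartic term can be
  removed if it is a Poisson bracket of the quadratic part with a quartic form. Quartic forms are
  spanned by fourth powers of linear forms \<open>X \<mapsto> a \<bullet> X\<close>, whose Hamiltonian flows
  are the polynomial shears \<open>X + t (a \<bullet> X)\<^sup>3 J a\<close>. Composing shears therefore gives an exactly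
  symplectic polynomial transformation, and no convergence question arises. What survives is the
  average of the quartic part over the tori of the two oscillators.\<close>

section \<open>Polynomial maps and canonical transformations\<close>

text \<open>In complex coordinates of the two oscillators, the bracket with the quadratic part is
  diagonal on monomials, with eigenvalues proportional to
  \<open>m * \<omega>\<^sub>1 + n * \<omega>\<^sub>2\<close>. A monomial resists removal exactly
  when this divisor vanishes: for m = n = 0 it belongs to the torus average, otherwise there is a
  resonance. The proof stays in real coordinates, where the divisors reappear as determinants of
  small linear systems. Besides the frequencies themselves, the difference of their squares and the
  two 3:1 differences must be nonzero; the former is, because 1 separates the squared frequencies,
  and the latter are by the nonresonance hypothesis. The second obstacle is that the coefficients
  are rational in the frequencies and \<delta>, whereas the frequencies are nested radicals in the
  parameters. Vieta's relations invert this dependence: \<alpha> and \<open>\<beta>\<^sup>2\<close>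
  are rational in the squared frequencies and \<delta>. The square roots that normalise the
  eigenvectors enter the quartic coefficients only through even powers.\<close>

definition polynomial_supported_on :: "('n \<Rightarrow> nat) set \<Rightarrow> (real^'n \<Rightarrow> real) \<Rightarrow> bool" where
  "polynomial_supported_on F f \<longleftrightarrow>
     (\<exists>c :: ('n \<Rightarrow> nat) \<Rightarrow> real. \<forall>x. f x = (\<Sum>k\<in>F. c k * (\<Prod>i\<in>UNIV. (x $ i) ^ k i)))"

lemma homogeneous_polynomial_iff:
  "homogeneous_polynomial d f \<longleftrightarrow> polynomial_supported_on {k. (\<Sum>i\<in>UNIV. k i) = d} f"
  unfolding homogeneous_polynomial_def polynomial_supported_on_def by simp

lemma finite_exponents_le: "finite {k :: 'n::finite \<Rightarrow> nat. (\<Sum>i\<in>UNIV. k i) \<le> d}"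
proof (rule finite_subset)
  show "{k :: 'n \<Rightarrow> nat. (\<Sum>i\<in>UNIV. k i) \<le> d} \<subseteq> PiE UNIV (\<lambda>_. {..d})"
  proof
    fix k :: "'n \<Rightarrow> nat" assume "k \<in> {k. (\<Sum>i\<in>UNIV. k i) \<le> d}"
    then have "k i \<le> d" for i
      using member_le_sum[of i UNIV k] by simp
    then show "k \<in> PiE UNIV (\<lambda>_. {..d})" by auto
  qed
  show "finite (PiE (UNIV :: 'n set) (\<lambda>_. {..d}))" by (rule finite_PiE) auto
qed

lemma finite_exponents_eq: "finite {k :: 'n::finite \<Rightarrow> nat. (\<Sum>i\<in>UNIV. k i) = d}"
  by (rule finite_subset[OF _ finite_exponents_le[of d]]) auto

lemma polynomial_supported_on_add:
  assumes "polynomial_supported_on F f" "polynomial_supported_on F g"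
  shows "polynomial_supported_on F (\<lambda>x. f x + g x)"
proof -
  obtain c where "\<And>x. f x = (\<Sum>k\<in>F. c k * (\<Prod>i\<in>UNIV. (x $ i) ^ k i))"
    using assms(1) unfolding polynomial_supported_on_def by blast
  moreover obtain d where "\<And>x. g x = (\<Sum>k\<in>F. d k * (\<Prod>i\<in>UNIV. (x $ i) ^ k i))"
    using assms(2) unfolding polynomial_supported_on_def by blast
  ultimately have "f x + g x = (\<Sum>k\<in>F. (c k + d k) * (\<Prod>i\<in>UNIV. (x $ i) ^ k i))" for x
    by (simp add: sum.distrib distrib_right)
  then show ?thesis unfolding polynomial_supported_on_def by (intro exI allI)
qed

lemma polynomial_supported_on_zero: "polynomial_supported_on F (\<lambda>x. 0)"
  unfolding polynomial_supported_on_def by (rule exI[of _ "\<lambda>_. 0"]) simp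

lemma polynomial_supported_on_sum:
  assumes "\<And>j. j \<in> A \<Longrightarrow> polynomial_supported_on F (f j)"
  shows "polynomial_supported_on F (\<lambda>x. \<Sum>j\<in>A. f j x)"
  using assms
  by (induction A rule: infinite_finite_induct)
     (auto intro: polynomial_supported_on_zero polynomial_supported_on_add)

lemma polynomial_supported_on_monomial:
  assumes "finite F" "k \<in> F"
  shows "polynomial_supported_on F (\<lambda>x. c * (\<Prod>i\<in>UNIV. (x $ i) ^ k i))"
  unfolding polynomial_supported_on_def
proof (intro exI allI)
  fix x :: "real^'a"
  have "(\<Sum>l\<in>F. (if l = k then c else 0) * (\<Prod>i\<in>UNIV. (x $ i) ^ l i)) =
        (\<Sum>l\<in>F. if l = k then c * (\<Prod>i\<in>UNIV. (x $ i) ^ k i) else 0)"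
    by (intro sum.cong) auto
  then show "c * (\<Prod>i\<in>UNIV. (x $ i) ^ k i) =
        (\<Sum>l\<in>F. (if l = k then c else 0) * (\<Prod>i\<in>UNIV. (x $ i) ^ l i))"
    using assms by simp
qed

lemma polynomial_supported_on_mono:
  assumes "polynomial_supported_on F f" "F \<subseteq> G" "finite G"
  shows "polynomial_supported_on G f"
proof -
  obtain c where c: "\<And>x. f x = (\<Sum>k\<in>F. c k * (\<Prod>i\<in>UNIV. (x $ i) ^ k i))"
    using assms(1) unfolding polynomial_supported_on_def by blast
  have "polynomial_supported_on G (\<lambda>x. \<Sum>k\<in>F. c k * (\<Prod>i\<in>UNIV. (x $ i) ^ k i))"
    using assms by (intro polynomial_supported_on_sum polynomial_supported_on_monomial) auto
  then show ?thesis by (simp add: c[symmetric])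
qed

lemma polynomial_supported_on_mult:
  assumes "polynomial_supported_on F f" "polynomial_supported_on G g" "finite E"
    "\<And>k l. k \<in> F \<Longrightarrow> l \<in> G \<Longrightarrow> (\<lambda>i. k i + l i) \<in> E"
  shows "polynomial_supported_on E (\<lambda>x. f x * g x)"
proof -
  obtain c where c: "\<And>x. f x = (\<Sum>k\<in>F. c k * (\<Prod>i\<in>UNIV. (x $ i) ^ k i))"
    using assms(1) unfolding polynomial_supported_on_def by blast
  obtain d where d: "\<And>x. g x = (\<Sum>k\<in>G. d k * (\<Prod>i\<in>UNIV. (x $ i) ^ k i))"
    using assms(2) unfolding polynomial_supported_on_def by blast
  have "polynomial_supported_on E
      (\<lambda>x. \<Sum>k\<in>F. \<Sum>l\<in>G. (c k * d l) * (\<Prod>i\<in>UNIV. (x $ i) ^ (k i + l i)))"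
    using assms(3,4) by (intro polynomial_supported_on_sum polynomial_supported_on_monomial)
  moreover have "f x * g x =
      (\<Sum>k\<in>F. \<Sum>l\<in>G. (c k * d l) * (\<Prod>i\<in>UNIV. (x $ i) ^ (k i + l i)))" for x
    unfolding c d sum_product power_add prod.distrib
    by (intro sum.cong refl) (simp add: mult_ac)
  ultimately show ?thesis by simp
qed

lemma homogeneous_polynomial_add:
  "homogeneous_polynomial d f \<Longrightarrow> homogeneous_polynomial d g \<Longrightarrow>
   homogeneous_polynomial d (\<lambda>x. f x + g x)"
  unfolding homogeneous_polynomial_iff by (rule polynomial_supported_on_add)

lemma homogeneous_polynomial_mult:
  "homogeneous_polynomial m f \<Longrightarrow> homogeneous_polynomial n g \<Longrightarrow>
   homogeneous_polynomial (m + n) (\<lambda>x. f x * g x)"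
  unfolding homogeneous_polynomial_iff
  by (erule polynomial_supported_on_mult) (auto simp: finite_exponents_eq sum.distrib)

lemma homogeneous_polynomial_zero: "homogeneous_polynomial d (\<lambda>x. 0)"
  unfolding homogeneous_polynomial_iff by (rule polynomial_supported_on_zero)

lemma homogeneous_polynomial_const: "homogeneous_polynomial 0 (\<lambda>x. c)"
  using polynomial_supported_on_monomial[of "{k. (\<Sum>i\<in>UNIV. k i) = 0}" "\<lambda>_. 0" c]
    finite_exponents_eq[of 0]
  unfolding homogeneous_polynomial_iff by simp

lemma homogeneous_polynomial_component: "homogeneous_polynomial 1 (\<lambda>x. x $ i)"
proof -
  have "(\<Prod>j\<in>UNIV. (x $ j) ^ (if j = i then 1 else 0)) = x $ i" for x :: "real^'a"
    by (simp add: if_distrib[of "\<lambda>k. _ ^ k"] cong: if_cong)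
  with polynomial_supported_on_monomial
      [of "{k. (\<Sum>i\<in>UNIV. k i) = 1}" "\<lambda>j. if j = i then 1 else 0" 1]
  show ?thesis unfolding homogeneous_polynomial_iff by (simp add: finite_exponents_eq[unfolded One_nat_def])
qed

section \<open>Analyticity of polynomial functions\<close>

lemma homogeneous_imp_bounded_degree:
  assumes "homogeneous_polynomial m f" "m \<le> d"
  shows "polynomial_supported_on {k. (\<Sum>i\<in>UNIV. k i) \<le> d} f"
  using assms unfolding homogeneous_polynomial_iff
  by (auto intro: polynomial_supported_on_mono finite_exponents_le)

text \<open>Analyticity asks for a power series centred at every point, so the induction runs over
  the translates \<open>f (a + v)\<close> for arbitrary \<open>a\<close>. The degree bound may grow
  with each constructor, since only the finiteness of the set of exponents matters.\<close>

lemma real_polynomial_function_translate_expansion: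
  fixes f :: "real^'n \<Rightarrow> real"
  assumes "real_polynomial_function f"
  shows "\<exists>d. polynomial_supported_on {k. (\<Sum>i\<in>UNIV. k i) \<le> d} (\<lambda>v. f (a + v))"
  using assms
proof induction
  case (linear f)
  have "f (a + v) = f a + (\<Sum>i\<in>UNIV. f (axis i 1) * v $ i)" for v
  proof -
    have "v = (\<Sum>i\<in>UNIV. (v $ i) *\<^sub>R axis i 1)"
      using basis_expansion[of v] by (simp add: scalar_mult_eq_scaleR)
    then have "f v = f (\<Sum>i\<in>UNIV. (v $ i) *\<^sub>R axis i 1)" by simp
    then show ?thesis using linear
      by (simp add: linear_simps bounded_linear.linear linear_sum linear_cmul mult.commute)
  qed
  moreover have "polynomial_supported_on {k. (\<Sum>i\<in>UNIV. k i) \<le> 1}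
      (\<lambda>v. f a + (\<Sum>i\<in>UNIV. f (axis i 1) * v $ i))"
    by (intro polynomial_supported_on_add polynomial_supported_on_sum
        homogeneous_imp_bounded_degree[OF homogeneous_polynomial_const]
        homogeneous_imp_bounded_degree[OF homogeneous_polynomial_mult
          [OF homogeneous_polynomial_const homogeneous_polynomial_component]]) auto
  ultimately show ?case by auto
next
  case (const c)
  then show ?case
    using homogeneous_imp_bounded_degree[OF homogeneous_polynomial_const] by blast
next
  case (add f g)
  then obtain d e where
    "polynomial_supported_on {k. (\<Sum>i\<in>UNIV. k i) \<le> d} (\<lambda>v. f (a + v))"
    "polynomial_supported_on {k. (\<Sum>i\<in>UNIV. k i) \<le> e} (\<lambda>v. g (a + v))" by blast
  then have "polynomial_supported_on {k. (\<Sum>i\<in>UNIV. k i) \<le> max d e} (\<lambda>v. f (a + v) + g (a + v))"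
    by (intro polynomial_supported_on_add; elim polynomial_supported_on_mono)
       (auto simp: finite_exponents_le)
  then show ?case by blast
next
  case (mult f g)
  then obtain d e where
    "polynomial_supported_on {k. (\<Sum>i\<in>UNIV. k i) \<le> d} (\<lambda>v. f (a + v))"
    "polynomial_supported_on {k. (\<Sum>i\<in>UNIV. k i) \<le> e} (\<lambda>v. g (a + v))" by blast
  then have "polynomial_supported_on {k. (\<Sum>i\<in>UNIV. k i) \<le> d + e} (\<lambda>v. f (a + v) * g (a + v))"
    by (rule polynomial_supported_on_mult) (auto simp: finite_exponents_le sum.distrib)
  then show ?case by blast
qed

lemma real_polynomial_function_imp_analytic:
  fixes f :: "real^'n \<Rightarrow> real"
  assumes "real_polynomial_function f"
  shows "real_analytic_at f a"
proof -
  obtain d where "polynomial_supported_on {k. (\<Sum>i\<in>UNIV. k i) \<le> d} (\<lambda>v. f (a + v))"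
    using real_polynomial_function_translate_expansion[OF assms] by blast
  then obtain c where
    c: "\<And>v. f (a + v) = (\<Sum>k | (\<Sum>i\<in>UNIV. k i) \<le> d. c k * (\<Prod>i\<in>UNIV. (v $ i) ^ k i))"
    unfolding polynomial_supported_on_def by blast
  \<comment> \<open>Coefficients beyond degree \<open>d\<close> default to 0, so the series is a
    finite sum for every \<open>v\<close>; the radius 1 chosen at the end is arbitrary.\<close>
  let ?c = "\<lambda>k. if (\<Sum>i\<in>UNIV. k i) \<le> d then c k else 0"
  have "((\<lambda>k. ?c k * (\<Prod>i\<in>UNIV. (v $ i) ^ k i)) has_sum f (a + v)) UNIV" for v
  proof (rule has_sum_cong_neutral[THEN iffD1])
    show "((\<lambda>k. c k * (\<Prod>i\<in>UNIV. (v $ i) ^ k i)) has_sum f (a + v)) {k. (\<Sum>i\<in>UNIV. k i) \<le> d}"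
      unfolding c by (intro has_sum_finite finite_exponents_le)
  qed auto
  then show ?thesis unfolding real_analytic_at_def by (intro exI[of _ ?c] exI[of _ 1]) auto
qed

text \<open>The symplectic form, written as a bilinear form so that the chain rule can be applied to
  derivatives instead of Jacobian matrices.\<close>

definition symplectic_form :: "real^4 \<Rightarrow> real^4 \<Rightarrow> real" where
  "symplectic_form u v = u $ 1 * v $ 3 + u $ 2 * v $ 4 - u $ 3 * v $ 1 - u $ 4 * v $ 2"

text \<open>Polynomial maps are closed under composition and analytic everywhere, so no composition
  of convergent power series has to be studied. The derivative is quantified existentially so that
  composites follow from the chain rule.\<close>

definition polynomial_canonical :: "(real^4 \<Rightarrow> real^4) \<Rightarrow> bool" where
  "polynomial_canonical \<phi> \<longleftrightarrow> polynomial_function \<phi> \<and>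
     (\<forall>X. \<exists>D. (\<phi> has_derivative D) (at X) \<and>
        (\<forall>u v. symplectic_form (D u) (D v) = symplectic_form u v))"

lemma polynomial_canonical_compose:
  assumes "polynomial_canonical f" "polynomial_canonical g"
  shows "polynomial_canonical (f \<circ> g)"
  unfolding polynomial_canonical_def
proof (intro conjI allI)
  show "polynomial_function (f \<circ> g)"
    using assms polynomial_function_compose unfolding polynomial_canonical_def by blast
next
  fix X
  obtain D where D: "(g has_derivative D) (at X)"
    "\<And>u v. symplectic_form (D u) (D v) = symplectic_form u v"
    using assms(2) unfolding polynomial_canonical_def by blast
  obtain E where E: "(f has_derivative E) (at (g X))"
    "\<And>u v. symplectic_form (E u) (E v) = symplectic_form u v"
    using assms(1) unfolding polynomial_canonical_def by blast
  show "\<exists>D. ((f \<circ> g) has_derivative D) (at X) \<and>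
        (\<forall>u v. symplectic_form (D u) (D v) = symplectic_form u v)"
    using diff_chain_at[OF D(1) E(1)] D(2) E(2) by (intro exI[of _ "E \<circ> D"]) auto
qed

lemma vector_4:
  "(vector [w, x, y, z] :: ('a::zero)^4) $ 1 = w"
  "(vector [w, x, y, z] :: ('a::zero)^4) $ 2 = x"
  "(vector [w, x, y, z] :: ('a::zero)^4) $ 3 = y"
  "(vector [w, x, y, z] :: ('a::zero)^4) $ 4 = z"
  unfolding vector_def by simp_all

lemma symplectic_J_mult_vec:
  "symplectic_J *v v = vector [v $ 3, v $ 4, - v $ 1, - v $ 2]"
  by (simp add: vec_eq_iff forall_4 matrix_vector_mult_def symplectic_J_def sum_4 vector_4)

lemma symplectic_form_eq_inner: "symplectic_form u v = u \<bullet> (symplectic_J *v v)"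
  by (simp add: symplectic_J_mult_vec inner_vec_def sum_4 symplectic_form_def vector_4)

text \<open>The matrix condition is the invariance of the bilinear form: testing the matrix product
  against all pairs \<open>u\<close>, \<open>v\<close> moves the transpose to the other side of the
  inner product.\<close>

lemma polynomial_canonical_imp_analytic_canonical:
  assumes "polynomial_canonical \<phi>"
  shows "analytic_canonical_on U \<phi>"
  unfolding analytic_canonical_on_def
proof (intro ballI conjI allI)
  fix X i
  have "polynomial_function \<phi>" using assms unfolding polynomial_canonical_def by blast
  then have "real_polynomial_function ((\<lambda>x. x $ i) \<circ> \<phi>)"
    unfolding polynomial_function_def using bounded_linear_vec_nth by blast
  then show "real_analytic_at (\<lambda>Y. \<phi> Y $ i) X"
    using real_polynomial_function_imp_analytic by (simp add: o_def)
next
  fix X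
  obtain D where D: "(\<phi> has_derivative D) (at X)"
    "\<And>u v. symplectic_form (D u) (D v) = symplectic_form u v"
    using assms unfolding polynomial_canonical_def by blast
  then show "\<phi> differentiable at X" unfolding differentiable_def by blast
  let ?M = "jacobian \<phi> (at X)"
  have M: "?M *v u = D u" for u
    using frechet_derivative_at[OF D(1)] has_derivative_linear[OF D(1)]
    by (simp add: jacobian_def matrix_works)
  have "u \<bullet> ((transpose ?M ** symplectic_J ** ?M) *v v) = u \<bullet> (symplectic_J *v v)" for u v
  proof -
    have "u \<bullet> ((transpose ?M ** symplectic_J ** ?M) *v v) =
        u \<bullet> (transpose ?M *v (symplectic_J *v (?M *v v)))"
      by (simp add: matrix_vector_mul_assoc matrix_mul_assoc)
    also have "\<dots> = (?M *v u) \<bullet> (symplectic_J *v (?M *v v))"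
      by (metis dot_lmul_matrix inner_commute vector_transpose_matrix transpose_transpose)
    also have "\<dots> = u \<bullet> (symplectic_J *v v)"
      using D(2) by (simp add: M symplectic_form_eq_inner)
    finally show ?thesis .
  qed
  then have "(transpose ?M ** symplectic_J ** ?M) *v v = symplectic_J *v v" for v
    using vector_eq_ldot by blast
  then show "transpose ?M ** symplectic_J ** ?M = symplectic_J"
    unfolding matrix_eq by blast
qed

section \<open>Removing quartic terms by shears\<close>

abbreviation O_norm :: "nat \<Rightarrow> (real^4 \<Rightarrow> real) set" where
  "O_norm n \<equiv> O[nhds 0](\<lambda>X. norm X ^ n)"

lemma O_norm_mult: "f \<in> O_norm m \<Longrightarrow> g \<in> O_norm n \<Longrightarrow> (\<lambda>X. f X * g X) \<in> O_norm (m + n)"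
  by (simp add: power_add landau_o.big.mult)

lemma eventually_norm_le_1: "\<forall>\<^sub>F X in nhds (0 :: real^4). norm X \<le> 1"
  unfolding eventually_nhds_metric by (rule exI[of _ 1]) auto

lemma O_norm_antimono: "f \<in> O_norm m \<Longrightarrow> n \<le> m \<Longrightarrow> f \<in> O_norm n"
  by (erule landau_o.big.trans, rule bigoI[of _ 1])
     (use eventually_norm_le_1 in \<open>auto elim!: eventually_mono intro: power_decreasing\<close>)

lemma O_norm_add: "f \<in> O_norm n \<Longrightarrow> g \<in> O_norm n \<Longrightarrow> (\<lambda>X. f X + g X) \<in> O_norm n"
  by (rule sum_in_bigo)

lemma O_norm_const: "(\<lambda>X. c) \<in> O_norm 0"
  by simp

lemma O_norm_component: "(\<lambda>X. X $ i) \<in> O_norm 1"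
  by (rule bigoI[of _ 1]) (auto simp: component_le_norm_cart)

lemma O_norm_inner: "(\<lambda>X. a \<bullet> X) \<in> O_norm 1"
  by (rule bigoI[of _ "norm a"]) (auto simp: Cauchy_Schwarz_ineq2)

lemma O_norm_of_components:
  assumes "\<And>i. (\<lambda>X. S X $ i) \<in> O_norm n"
  shows "(\<lambda>X. norm (S X)) \<in> O_norm n"
proof -
  have "(\<lambda>X. \<Sum>i\<in>UNIV. norm (S X $ i)) \<in> O_norm n"
    using assms by (intro big_sum_in_bigo) auto
  moreover have "(\<lambda>X. norm (S X)) \<in> O[nhds 0](\<lambda>X. \<Sum>i\<in>UNIV. norm (S X $ i))"
  proof (rule bigoI[of _ 1], intro always_eventually allI)
    fix X
    show "norm (norm (S X)) \<le> 1 * norm (\<Sum>i\<in>UNIV. norm (S X $ i))"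
      using norm_le_l1_cart[of "S X"] by (simp add: sum_nonneg)
  qed
  ultimately show ?thesis by (rule landau_o.big.trans[rotated])
qed

text \<open>The bound on \<open>S\<close> forces \<open>S\<close> to tend to 0, so the estimate for
  \<open>f\<close> can be evaluated along \<open>S\<close>. Because \<open>O_norm\<close> uses
  \<open>nhds 0\<close> instead of the punctured filter, \<open>S X\<close> may vanish away from the
  origin.\<close>

lemma O_norm_compose:
  assumes "f \<in> O_norm n" "(\<lambda>X. norm (S X)) \<in> O_norm 1"
  shows "(\<lambda>X. f (S X)) \<in> O_norm n"
proof -
  have "filterlim S (nhds 0) (nhds 0)"
  proof -
    obtain c where c: "\<forall>\<^sub>F X in nhds 0. norm (norm (S X)) \<le> c * norm (norm X ^ 1)"
      using assms(2) by (rule landau_o.bigE)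
    have "((\<lambda>X. c * norm X) \<longlongrightarrow> c * norm (0 :: real^4)) (nhds (0 :: real^4))"
      by (intro tendsto_mult tendsto_const tendsto_norm filterlim_ident)
    then show ?thesis using c by (intro Lim_null_comparison[of S "\<lambda>X. c * norm X"]) auto
  qed
  with assms(1) have "(\<lambda>X. f (S X)) \<in> O[nhds 0](\<lambda>X. norm (S X) ^ n)"
    by (rule landau_o.big.compose)
  also have "(\<lambda>X. norm (S X) ^ n) \<in> O_norm n"
    using landau_o.big_power[OF assms(2), of n] by simp
  finally show ?thesis .
qed

definition near_identity :: "(real^4 \<Rightarrow> real^4) \<Rightarrow> bool" where
  "near_identity S \<longleftrightarrow> (\<forall>i. (\<lambda>X. S X $ i - X $ i) \<in> O_norm 3)"

lemma near_identity_norm: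
  assumes "near_identity S"
  shows "(\<lambda>X. norm (S X)) \<in> O_norm 1"
proof (rule O_norm_of_components)
  fix i
  have "(\<lambda>X. (S X $ i - X $ i) + X $ i) \<in> O_norm 1"
    using assms unfolding near_identity_def
    by (intro O_norm_add O_norm_component O_norm_antimono[of _ 3 1]) auto
  then show "(\<lambda>X. S X $ i) \<in> O_norm 1" by simp
qed

lemma near_identity_compose:
  assumes "near_identity S" "near_identity T"
  shows "near_identity (S \<circ> T)"
  unfolding near_identity_def
proof
  fix i
  have "(\<lambda>X. S (T X) $ i - T X $ i) \<in> O_norm 3"
    using assms O_norm_compose[of "\<lambda>X. S X $ i - X $ i" 3 T] near_identity_norm
    unfolding near_identity_def by blast
  then have "(\<lambda>X. (S (T X) $ i - T X $ i) + (T X $ i - X $ i)) \<in> O_norm 3"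
    using assms unfolding near_identity_def by (intro O_norm_add) auto
  then show "(\<lambda>X. (S \<circ> T) X $ i - X $ i) \<in> O_norm 3" by simp
qed

text \<open>A degree-\<open>n\<close> form changes only at order \<open>n + 2\<close> under a map that is the identity up to
  cubic terms; this property is stable under sums and products.\<close>

definition formlike :: "nat \<Rightarrow> (real^4 \<Rightarrow> real) \<Rightarrow> bool" where
  "formlike n f \<longleftrightarrow> f \<in> O_norm n \<and>
     (\<forall>S. near_identity S \<longrightarrow> (\<lambda>X. f (S X) - f X) \<in> O_norm (n + 2))"

lemma formlike_component: "formlike 1 (\<lambda>X. X $ i)"
  unfolding formlike_def near_identity_def using O_norm_component by (simp add: numeral_3_eq_3)

lemma formlike_const: "formlike 0 (\<lambda>X. c)"
  unfolding formlike_def by simp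

lemma formlike_add: "formlike n f \<Longrightarrow> formlike n g \<Longrightarrow> formlike n (\<lambda>X. f X + g X)"
  unfolding formlike_def
proof (intro conjI allI impI; elim conjE)
  fix S assume *: "\<forall>S. near_identity S \<longrightarrow> (\<lambda>X. f (S X) - f X) \<in> O_norm (n + 2)"
    "\<forall>S. near_identity S \<longrightarrow> (\<lambda>X. g (S X) - g X) \<in> O_norm (n + 2)" "near_identity S"
  then have "(\<lambda>X. (f (S X) - f X) + (g (S X) - g X)) \<in> O_norm (n + 2)"
    by (intro O_norm_add) blast+
  then show "(\<lambda>X. f (S X) + g (S X) - (f X + g X)) \<in> O_norm (n + 2)"
    by (simp add: algebra_simps)
qed (rule O_norm_add)

lemma formlikeD:
  assumes "formlike n f"
  shows "f \<in> O_norm n" "near_identity S \<Longrightarrow> (\<lambda>X. f (S X) - f X) \<in> O_norm (n + 2)"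
  using assms unfolding formlike_def by simp_all

lemma formlike_mult:
  assumes f: "formlike m f" and g: "formlike n g"
  shows "formlike (m + n) (\<lambda>X. f X * g X)"
  unfolding formlike_def
proof (intro conjI allI impI)
  show "(\<lambda>X. f X * g X) \<in> O_norm (m + n)"
    by (rule O_norm_mult[OF formlikeD(1)[OF f] formlikeD(1)[OF g]])
  fix S assume S: "near_identity S"
  have 1: "(\<lambda>X. (f (S X) - f X) * g (S X)) \<in> O_norm ((m + 2) + n)"
    by (rule O_norm_mult[OF formlikeD(2)[OF f S]
          O_norm_compose[OF formlikeD(1)[OF g] near_identity_norm[OF S]]])
  have 2: "(\<lambda>X. f X * (g (S X) - g X)) \<in> O_norm (m + (n + 2))"
    by (rule O_norm_mult[OF formlikeD(1)[OF f] formlikeD(2)[OF g S]])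
  have eq: "m + n + 2 = m + 2 + n" "m + n + 2 = m + (n + 2)" by simp_all
  have "(\<lambda>X. (f (S X) - f X) * g (S X) + f X * (g (S X) - g X)) \<in> O_norm (m + n + 2)"
    by (rule O_norm_add[OF 1[folded eq(1)] 2[folded eq(2)]])
  then show "(\<lambda>X. f (S X) * g (S X) - f X * g X) \<in> O_norm (m + n + 2)"
    by (simp add: algebra_simps del: power_Suc)
qed

lemma formlike_sum:
  "(\<And>j. j \<in> A \<Longrightarrow> formlike n (f j)) \<Longrightarrow> formlike n (\<lambda>X. \<Sum>j\<in>A. f j X)"
proof (induction A rule: infinite_finite_induct)
  case (insert j A)
  then show ?case by (simp add: formlike_add)
qed (simp_all add: formlike_def)

lemma formlike_power: "formlike n f \<Longrightarrow> formlike (n * k) (\<lambda>X. f X ^ k)"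
proof (induction k)
  case (Suc k)
  then have "formlike (n + n * k) (\<lambda>X. f X * f X ^ k)" by (intro formlike_mult) auto
  then show ?case by simp
qed (use formlike_const[of 1] in simp)

lemma formlike_prod:
  "(\<And>j. j \<in> A \<Longrightarrow> formlike (n j) (f j)) \<Longrightarrow> formlike (\<Sum>j\<in>A. n j) (\<lambda>X. \<Prod>j\<in>A. f j X)"
proof (induction A rule: infinite_finite_induct)
  case (insert j A)
  then have "formlike (n j + (\<Sum>j\<in>A. n j)) (\<lambda>X. f j X * (\<Prod>j\<in>A. f j X))"
    by (intro formlike_mult) simp_all
  with insert show ?case by simp
qed (simp_all add: formlike_const)

lemma formlike_scale: "formlike n f \<Longrightarrow> formlike n (\<lambda>X. c * f X)"
  using formlike_mult[OF formlike_const, of n f c] by simp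

lemma homogeneous_polynomial_imp_formlike:
  fixes f :: "real^4 \<Rightarrow> real"
  assumes "homogeneous_polynomial d f"
  shows "formlike d f"
proof -
  obtain c where c: "\<And>x. f x = (\<Sum>k | (\<Sum>i\<in>UNIV. k i) = d. c k * (\<Prod>i\<in>UNIV. (x $ i) ^ k i))"
    using assms unfolding homogeneous_polynomial_def by blast
  have p: "formlike (k i) (\<lambda>x. (x $ i) ^ k i)" for k and i :: 4
    using formlike_power[OF formlike_component[of i], of "k i"] by simp
  have "formlike (\<Sum>i\<in>UNIV. k i) (\<lambda>x :: real^4. \<Prod>i\<in>UNIV. (x $ i) ^ k i)" for k
    by (rule formlike_prod) (rule p)
  then have "formlike d (\<lambda>x. \<Sum>k | (\<Sum>i\<in>UNIV. k i) = d. c k * (\<Prod>i\<in>UNIV. (x $ i) ^ k i))"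
    by (intro formlike_sum formlike_scale) (metis (mono_tags) mem_Collect_eq)
  then show ?thesis by (simp add: c[symmetric])
qed

section \<open>Quartic shears and the terms they produce\<close>

definition shear :: "real \<Rightarrow> real^4 \<Rightarrow> real^4 \<Rightarrow> real^4" where
  "shear t a X = X + (t * (a \<bullet> X) ^ 3) *\<^sub>R (symplectic_J *v a)"

lemma symplectic_form_add_scaleR:
  "symplectic_form (u + r *\<^sub>R w) (v + s *\<^sub>R w) =
     symplectic_form u v + r * symplectic_form w v + s * symplectic_form u w"
  by (simp add: symplectic_form_def algebra_simps)

lemma symplectic_form_J:
  "symplectic_form (symplectic_J *v a) v = a \<bullet> v"
  "symplectic_form u (symplectic_J *v a) = - (u \<bullet> a)"
  by (simp_all add: symplectic_form_def symplectic_J_mult_vec vector_4 inner_vec_def sum_4)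

text \<open>The shear is the time-\<open>t\<close> flow of \<open>(a \<bullet> X) ^ 4 / 4\<close>:
  the vector \<open>symplectic_J *v a\<close> is orthogonal to \<open>a\<close>, so
  \<open>a \<bullet> X\<close> is conserved and trajectories are straight lines. Its derivative at
  each point is a symplectic transvection along that vector; the two first-order contributions to
  the form cancel by antisymmetry.\<close>

lemma shear_canonical: "polynomial_canonical (shear t a)"
  unfolding polynomial_canonical_def
proof (intro conjI allI)
  show "polynomial_function (shear t a)"
    unfolding shear_def
    by (intro polynomial_function_add polynomial_function_mult polynomial_function_id
        polynomial_function_const real_polynomial_function_eq[THEN iffD1] real_polynomial_function.intros(1,2,4)
        real_polynomial_function_power bounded_linear_inner_right)
  fix X
  let ?D = "\<lambda>u. u + (3 * t * (a \<bullet> X)\<^sup>2 * (a \<bullet> u)) *\<^sub>R (symplectic_J *v a)"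
  have "(shear t a has_derivative ?D) (at X)"
    unfolding shear_def
    by (auto intro!: derivative_eq_intros simp: power2_eq_square mult_ac)
  moreover have "symplectic_form (?D u) (?D v) = symplectic_form u v" for u v
    by (simp add: symplectic_form_add_scaleR symplectic_form_J inner_commute)
  ultimately show "\<exists>D. (shear t a has_derivative D) (at X) \<and>
      (\<forall>u v. symplectic_form (D u) (D v) = symplectic_form u v)" by blast
qed

lemma shear_near_identity: "near_identity (shear t a)"
  unfolding near_identity_def
proof
  fix i
  have "(\<lambda>X. (t * (symplectic_J *v a) $ i) * ((a \<bullet> X) * ((a \<bullet> X) * (a \<bullet> X)))) \<in> O_norm (0 + (1 + (1 + 1)))"
    by (intro O_norm_mult O_norm_const O_norm_inner)
  then show "(\<lambda>X. shear t a X $ i - X $ i) \<in> O_norm 3"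
    by (simp add: shear_def power3_eq_cube mult_ac numeral_3_eq_3)
qed

text \<open>The derivative of the quadratic part along the Hamiltonian vector field of the linear form
  \<open>X \<mapsto> a \<bullet> X\<close>.\<close>

definition oscillator_bracket :: "real \<Rightarrow> real \<Rightarrow> real^4 \<Rightarrow> real^4 \<Rightarrow> real" where
  "oscillator_bracket \<omega>\<^sub>1 \<omega>\<^sub>2 a X =
     \<omega>\<^sub>1 * (a $ 3 * X $ 1 - a $ 1 * X $ 3) + \<omega>\<^sub>2 * (a $ 4 * X $ 2 - a $ 2 * X $ 4)"

text \<open>An exact second-order Taylor expansion. For a shear, \<open>k\<close> is a cubic form,
  so the middle term is the quartic change and the last term has degree six.\<close>

lemma quadratic_part_add_scaleR_J:
  "quadratic_part \<omega>\<^sub>1 \<omega>\<^sub>2 (X + k *\<^sub>R (symplectic_J *v a)) =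
     quadratic_part \<omega>\<^sub>1 \<omega>\<^sub>2 X + k * oscillator_bracket \<omega>\<^sub>1 \<omega>\<^sub>2 a X +
     k\<^sup>2 * quadratic_part \<omega>\<^sub>1 \<omega>\<^sub>2 (symplectic_J *v a)"
  by (simp add: quadratic_part_def oscillator_bracket_def symplectic_J_mult_vec vector_4
      field_simps power2_eq_square)

text \<open>Quartic terms that a composition of shears can remove: the image of the Poisson bracket with
  the quadratic part, spanned by its values on fourth powers of linear forms.\<close>

inductive removable :: "real \<Rightarrow> real \<Rightarrow> (real^4 \<Rightarrow> real) \<Rightarrow> bool" for \<omega>\<^sub>1 \<omega>\<^sub>2 where
  fourth_power: "removable \<omega>\<^sub>1 \<omega>\<^sub>2 (\<lambda>X. t * (a \<bullet> X) ^ 3 * oscillator_bracket \<omega>\<^sub>1 \<omega>\<^sub>2 a X)"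
| add: "removable \<omega>\<^sub>1 \<omega>\<^sub>2 f \<Longrightarrow> removable \<omega>\<^sub>1 \<omega>\<^sub>2 g \<Longrightarrow> removable \<omega>\<^sub>1 \<omega>\<^sub>2 (\<lambda>X. f X + g X)"

lemma homogeneous_polynomial_inner: "homogeneous_polynomial 1 (\<lambda>X. a \<bullet> X)"
  unfolding homogeneous_polynomial_iff inner_vec_def inner_real_def
  by (intro polynomial_supported_on_sum,
      fold homogeneous_polynomial_iff)
     (use homogeneous_polynomial_mult[OF homogeneous_polynomial_const homogeneous_polynomial_component]
      in simp)

lemma removable_imp_formlike: "removable \<omega>\<^sub>1 \<omega>\<^sub>2 f \<Longrightarrow> formlike 4 f"
proof (induction rule: removable.induct)
  case (fourth_power t a)
  have "oscillator_bracket \<omega>\<^sub>1 \<omega>\<^sub>2 a X =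
      vector [\<omega>\<^sub>1 * a $ 3, \<omega>\<^sub>2 * a $ 4, - \<omega>\<^sub>1 * a $ 1, - \<omega>\<^sub>2 * a $ 2] \<bullet> X" for X
    by (simp add: oscillator_bracket_def inner_vec_def sum_4 vector_4 algebra_simps)
  then have "formlike 1 (oscillator_bracket \<omega>\<^sub>1 \<omega>\<^sub>2 a)"
    using homogeneous_polynomial_imp_formlike[OF homogeneous_polynomial_inner] by presburger
  then have "formlike (0 + 1 * 3 + 1) (\<lambda>X. t * (a \<bullet> X) ^ 3 * oscillator_bracket \<omega>\<^sub>1 \<omega>\<^sub>2 a X)"
    by (rule formlike_mult[OF formlike_mult[OF formlike_const
          formlike_power[OF homogeneous_polynomial_imp_formlike[OF homogeneous_polynomial_inner]]]])
  then show ?case by simp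
qed (rule formlike_add)

text \<open>Composition of near-identity maps adds their quartic effects, because evaluating a
  quartic form after such a map alters it only at order six. Hence generators can be treated one at
  a time.\<close>

lemma removable_imp_canonical:
  assumes "removable \<omega>\<^sub>1 \<omega>\<^sub>2 f"
  shows "\<exists>S. polynomial_canonical S \<and> near_identity S \<and> S 0 = 0 \<and>
    (\<lambda>X. quadratic_part \<omega>\<^sub>1 \<omega>\<^sub>2 (S X) - quadratic_part \<omega>\<^sub>1 \<omega>\<^sub>2 X - f X) \<in> O_norm 5"
  using assms
proof (induction rule: removable.induct)
  case (fourth_power t a)
  have "(\<lambda>X. (t\<^sup>2 * quadratic_part \<omega>\<^sub>1 \<omega>\<^sub>2 (symplectic_J *v a)) * (a \<bullet> X) ^ 6) \<in> O_norm (0 + 1 * 6)"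
    using formlike_power[OF homogeneous_polynomial_imp_formlike[OF homogeneous_polynomial_inner], of 6 a]
    by (intro O_norm_mult O_norm_const) (simp add: formlike_def)
  then have "(\<lambda>X. (t\<^sup>2 * quadratic_part \<omega>\<^sub>1 \<omega>\<^sub>2 (symplectic_J *v a)) * (a \<bullet> X) ^ 6) \<in> O_norm 5"
    by (rule O_norm_antimono) simp
  also have "(\<lambda>X. (t\<^sup>2 * quadratic_part \<omega>\<^sub>1 \<omega>\<^sub>2 (symplectic_J *v a)) * (a \<bullet> X) ^ 6) =
    (\<lambda>X. quadratic_part \<omega>\<^sub>1 \<omega>\<^sub>2 (shear t a X) - quadratic_part \<omega>\<^sub>1 \<omega>\<^sub>2 X -
      t * (a \<bullet> X) ^ 3 * oscillator_bracket \<omega>\<^sub>1 \<omega>\<^sub>2 a X)"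
    by (simp add: shear_def quadratic_part_add_scaleR_J power_mult_distrib mult_ac flip: power_mult)
  finally show ?case
    by (intro exI[of _ "shear t a"]) (simp add: shear_canonical shear_near_identity, simp add: shear_def)
next
  case (add f g)
  obtain S where S: "polynomial_canonical S" "near_identity S" "S 0 = 0"
    "(\<lambda>X. quadratic_part \<omega>\<^sub>1 \<omega>\<^sub>2 (S X) - quadratic_part \<omega>\<^sub>1 \<omega>\<^sub>2 X - f X) \<in> O_norm 5"
    using add.IH by blast
  obtain T where T: "polynomial_canonical T" "near_identity T" "T 0 = 0"
    "(\<lambda>X. quadratic_part \<omega>\<^sub>1 \<omega>\<^sub>2 (T X) - quadratic_part \<omega>\<^sub>1 \<omega>\<^sub>2 X - g X) \<in> O_norm 5"
    using add.IH by blast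
  have "(\<lambda>X. f (T X) - f X) \<in> O_norm 5"
    using removable_imp_formlike[OF add.hyps(1)] T(2) unfolding formlike_def
    by (intro O_norm_antimono[of _ "4 + 2" 5]) auto
  \<comment> \<open>Telescoping: the effect of \<open>S\<close> evaluated at \<open>T X\<close>, the
    effect of \<open>T\<close>, and the error of replacing \<open>f (T X)\<close> by
    \<open>f X\<close>.\<close>
  then have "(\<lambda>X. (quadratic_part \<omega>\<^sub>1 \<omega>\<^sub>2 (S (T X)) - quadratic_part \<omega>\<^sub>1 \<omega>\<^sub>2 (T X) - f (T X))
     + (quadratic_part \<omega>\<^sub>1 \<omega>\<^sub>2 (T X) - quadratic_part \<omega>\<^sub>1 \<omega>\<^sub>2 X - g X) + (f (T X) - f X)) \<in> O_norm 5"
    using O_norm_compose[OF S(4) near_identity_norm[OF T(2)]] T(4)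
    by (intro O_norm_add)
  then have "(\<lambda>X. quadratic_part \<omega>\<^sub>1 \<omega>\<^sub>2 ((S \<circ> T) X) - quadratic_part \<omega>\<^sub>1 \<omega>\<^sub>2 X - (f X + g X)) \<in> O_norm 5"
    by (simp add: algebra_simps)
  then show ?case
    using polynomial_canonical_compose[OF S(1) T(1)] near_identity_compose[OF S(2) T(2)] S(3) T(3)
    by (intro exI[of _ "S \<circ> T"]) (simp del: o_apply, simp)
qed

section \<open>Normal forms of quartic monomials\<close>

lemma removable_scale: "removable \<omega>\<^sub>1 \<omega>\<^sub>2 f \<Longrightarrow> removable \<omega>\<^sub>1 \<omega>\<^sub>2 (\<lambda>X. c * f X)"
proof (induction rule: removable.induct)
  case (fourth_power t a)
  then show ?case
    using removable.fourth_power[of \<omega>\<^sub>1 \<omega>\<^sub>2 "c * t" a] by (simp add: mult.assoc)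
next
  case (add f g)
  then show ?case
    using removable.add[of \<omega>\<^sub>1 \<omega>\<^sub>2 "\<lambda>X. c * f X" "\<lambda>X. c * g X"] by (simp add: distrib_left)
qed

lemma removable_cong: "removable \<omega>\<^sub>1 \<omega>\<^sub>2 f \<Longrightarrow> (\<And>X. g X = f X) \<Longrightarrow> removable \<omega>\<^sub>1 \<omega>\<^sub>2 g"
  by presburger

lemma removable_combine:
  "removable \<omega>\<^sub>1 \<omega>\<^sub>2 f \<Longrightarrow> removable \<omega>\<^sub>1 \<omega>\<^sub>2 g \<Longrightarrow>
   (\<And>X. h X = c * f X + d * g X) \<Longrightarrow> removable \<omega>\<^sub>1 \<omega>\<^sub>2 h"
  by (rule removable_cong[OF removable.add[OF removable_scale removable_scale]])

text \<open>The primes stand for a derivation. The signed sum of the eight fourth powers of a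
  \<plusminus> b \<plusminus> c \<plusminus> d equals 192 times the product abcd; differentiating a
  fourth power yields a factor 4, which leaves 192 / 4 = 48.\<close>

lemma polarization_identity:
  fixes a b c d a' b' c' d' :: real
  shows "a' * b * c * d + a * b' * c * d + a * b * c' * d + a * b * c * d' = 1 / 48 *
   (((a + b + c + d) ^ 3 * (a' + b' + c' + d') - (a + b + c - d) ^ 3 * (a' + b' + c' - d'))
     - ((a + b - c + d) ^ 3 * (a' + b' - c' + d') - (a + b - c - d) ^ 3 * (a' + b' - c' - d'))
   - (((a - b + c + d) ^ 3 * (a' - b' + c' + d') - (a - b + c - d) ^ 3 * (a' - b' + c' - d'))
     - ((a - b - c + d) ^ 3 * (a' - b' - c' + d') - (a - b - c - d) ^ 3 * (a' - b' - c' - d'))))" (is "?l = 1 / 48 * ?r")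
proof -
  have "48 * ?l = ?r" by algebra
  from arg_cong[OF this, of "\<lambda>x. 1 / 48 * x"] show ?thesis
    by (simp del: distrib_left_numeral)
qed

lemma oscillator_bracket_linear:
  "oscillator_bracket \<omega>\<^sub>1 \<omega>\<^sub>2 (a + b) X =
     oscillator_bracket \<omega>\<^sub>1 \<omega>\<^sub>2 a X + oscillator_bracket \<omega>\<^sub>1 \<omega>\<^sub>2 b X"
  "oscillator_bracket \<omega>\<^sub>1 \<omega>\<^sub>2 (a - b) X =
     oscillator_bracket \<omega>\<^sub>1 \<omega>\<^sub>2 a X - oscillator_bracket \<omega>\<^sub>1 \<omega>\<^sub>2 b X"
  by (simp_all add: oscillator_bracket_def algebra_simps)

text \<open>By the Leibniz rule this is the bracket of the quadratic part with a product of four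
  linear forms, up to sign convention. Polarization reduces it to eight generators.\<close>

lemma removable_product:
  fixes \<omega>\<^sub>1 \<omega>\<^sub>2
  defines "D \<equiv> oscillator_bracket \<omega>\<^sub>1 \<omega>\<^sub>2"
  shows "removable \<omega>\<^sub>1 \<omega>\<^sub>2 (\<lambda>X. D a X * (b \<bullet> X) * (c \<bullet> X) * (d \<bullet> X) + (a \<bullet> X) * D b X * (c \<bullet> X) * (d \<bullet> X)
    + (a \<bullet> X) * (b \<bullet> X) * D c X * (d \<bullet> X) + (a \<bullet> X) * (b \<bullet> X) * (c \<bullet> X) * D d X)"
proof -
  let ?r = "\<lambda>v X. (v \<bullet> X) ^ 3 * D v X"
  have r: "removable \<omega>\<^sub>1 \<omega>\<^sub>2 (?r v)" for v
    using removable.fourth_power[of _ _ 1 v] by (simp add: D_def)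
  note diff = removable_combine[where c = 1 and d = "-1"]
  have "removable \<omega>\<^sub>1 \<omega>\<^sub>2 (\<lambda>X.
     ((?r (a + b + c + d) X - ?r (a + b + c - d) X) - (?r (a + b - c + d) X - ?r (a + b - c - d) X))
   - ((?r (a - b + c + d) X - ?r (a - b + c - d) X) - (?r (a - b - c + d) X - ?r (a - b - c - d) X)))"
    by (rule diff[OF diff[OF diff[OF r r] diff[OF r r]] diff[OF diff[OF r r] diff[OF r r]]]) simp_all
  from removable_scale[OF this, of "1 / 48"] show ?thesis
  proof (rule removable_cong)
    fix X
    show "D a X * (b \<bullet> X) * (c \<bullet> X) * (d \<bullet> X) + (a \<bullet> X) * D b X * (c \<bullet> X) * (d \<bullet> X)
        + (a \<bullet> X) * (b \<bullet> X) * D c X * (d \<bullet> X) + (a \<bullet> X) * (b \<bullet> X) * (c \<bullet> X) * D d X =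
      1 / 48 * (((?r (a + b + c + d) X - ?r (a + b + c - d) X) - (?r (a + b - c + d) X - ?r (a + b - c - d) X))
       - ((?r (a - b + c + d) X - ?r (a - b + c - d) X) - (?r (a - b - c + d) X - ?r (a - b - c - d) X)))"
      unfolding D_def oscillator_bracket_linear inner_add_left inner_diff_left
      by (rule polarization_identity)
  qed
qed

lemma oscillator_bracket_axis:
  "oscillator_bracket \<omega>\<^sub>1 \<omega>\<^sub>2 (axis 1 1) X = - \<omega>\<^sub>1 * X $ 3"
  "oscillator_bracket \<omega>\<^sub>1 \<omega>\<^sub>2 (axis 2 1) X = - \<omega>\<^sub>2 * X $ 4"
  "oscillator_bracket \<omega>\<^sub>1 \<omega>\<^sub>2 (axis 3 1) X = \<omega>\<^sub>1 * X $ 1"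
  "oscillator_bracket \<omega>\<^sub>1 \<omega>\<^sub>2 (axis 4 1) X = \<omega>\<^sub>2 * X $ 2"
  by (simp_all add: oscillator_bracket_def axis_def)

text \<open>Each choice of the four indices gives one relation between quartic monomials modulo
  removable terms. All linear systems below are assembled from such relations.\<close>

lemma removable_monomial:
  "removable \<omega>\<^sub>1 \<omega>\<^sub>2 (\<lambda>X.
     oscillator_bracket \<omega>\<^sub>1 \<omega>\<^sub>2 (axis i 1) X * X $ j * X $ k * X $ l
   + X $ i * oscillator_bracket \<omega>\<^sub>1 \<omega>\<^sub>2 (axis j 1) X * X $ k * X $ l
   + X $ i * X $ j * oscillator_bracket \<omega>\<^sub>1 \<omega>\<^sub>2 (axis k 1) X * X $ l
   + X $ i * X $ j * X $ k * oscillator_bracket \<omega>\<^sub>1 \<omega>\<^sub>2 (axis l 1) X)"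
  using removable_product[of \<omega>\<^sub>1 \<omega>\<^sub>2 "axis i 1" "axis j 1" "axis k 1" "axis l 1"]
  by (simp add: inner_axis')

text \<open>The two removable terms are the brackets with \<open>Q ^ 3 * P\<close> and
  \<open>Q * P ^ 3\<close>. The numbers 3/8 and 1/8 are the means of the fourth power of the cosine
  and of the product of squared cosine and squared sine over a circle; the multipliers solve the
  resulting linear system.\<close>

lemma single_mode_normalization:
  assumes "\<omega> \<noteq> 0"
    and "removable \<omega>\<^sub>1 \<omega>\<^sub>2 (\<lambda>X. \<omega> * (Q X ^ 4 - 3 * (Q X)\<^sup>2 * (P X)\<^sup>2))"
    and "removable \<omega>\<^sub>1 \<omega>\<^sub>2 (\<lambda>X. \<omega> * (3 * (Q X)\<^sup>2 * (P X)\<^sup>2 - P X ^ 4))"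
  shows "removable \<omega>\<^sub>1 \<omega>\<^sub>2 (\<lambda>X. Q X ^ 4 - 3 / 8 * ((Q X)\<^sup>2 + (P X)\<^sup>2)\<^sup>2)"
    and "removable \<omega>\<^sub>1 \<omega>\<^sub>2 (\<lambda>X. (Q X)\<^sup>2 * (P X)\<^sup>2 - 1 / 8 * ((Q X)\<^sup>2 + (P X)\<^sup>2)\<^sup>2)"
proof -
  show "removable \<omega>\<^sub>1 \<omega>\<^sub>2 (\<lambda>X. Q X ^ 4 - 3 / 8 * ((Q X)\<^sup>2 + (P X)\<^sup>2)\<^sup>2)"
    by (rule removable_combine[OF assms(2,3), of _ "5 / (8 * \<omega>)" "3 / (8 * \<omega>)"])
       (use assms(1) in \<open>simp add: field_simps power2_eq_square power4_eq_xxxx\<close>)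
  show "removable \<omega>\<^sub>1 \<omega>\<^sub>2 (\<lambda>X. (Q X)\<^sup>2 * (P X)\<^sup>2 - 1 / 8 * ((Q X)\<^sup>2 + (P X)\<^sup>2)\<^sup>2)"
    by (rule removable_combine[OF assms(2,3), of _ "- 1 / (8 * \<omega>)" "1 / (8 * \<omega>)"])
       (use assms(1) in \<open>simp add: field_simps power2_eq_square power4_eq_xxxx\<close>)
qed

text \<open>\<open>A\<close>, \<open>B\<close>, \<open>C\<close>, \<open>E\<close> are the brackets
  with \<open>Q P q\<^sup>2\<close>, \<open>Q P p\<^sup>2\<close>, \<open>Q\<^sup>2 q p\<close>,
  \<open>P\<^sup>2 q p\<close>. The differences \<open>A - B\<close> and \<open>C - E\<close> both
  contain the product of \<open>Q\<^sup>2 - P\<^sup>2\<close> and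
  \<open>q\<^sup>2 - p\<^sup>2\<close>; eliminating it isolates the product of all four variables
  with the 1:1 divisor in front. Then the four products of squares become congruent to each other,
  hence to their arithmetic mean, which is the torus average.\<close>

lemma mixed_mode_normalization:
  assumes "\<omega> \<noteq> 0" "\<omega>' \<noteq> 0" "\<omega>\<^sup>2 \<noteq> \<omega>'\<^sup>2"
    and A: "removable \<omega>\<^sub>1 \<omega>\<^sub>2 (\<lambda>X. \<omega> * ((Q X)\<^sup>2 - (P X)\<^sup>2) * (q X)\<^sup>2 - 2 * \<omega>' * (Q X * P X * q X * p X))"
    and B: "removable \<omega>\<^sub>1 \<omega>\<^sub>2 (\<lambda>X. \<omega> * ((Q X)\<^sup>2 - (P X)\<^sup>2) * (p X)\<^sup>2 + 2 * \<omega>' * (Q X * P X * q X * p X))"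
    and C: "removable \<omega>\<^sub>1 \<omega>\<^sub>2 (\<lambda>X. \<omega>' * (Q X)\<^sup>2 * ((q X)\<^sup>2 - (p X)\<^sup>2) - 2 * \<omega> * (Q X * P X * q X * p X))"
    and E: "removable \<omega>\<^sub>1 \<omega>\<^sub>2 (\<lambda>X. \<omega>' * (P X)\<^sup>2 * ((q X)\<^sup>2 - (p X)\<^sup>2) + 2 * \<omega> * (Q X * P X * q X * p X))"
  shows "removable \<omega>\<^sub>1 \<omega>\<^sub>2 (\<lambda>X. Q X * P X * q X * p X)"
    and "removable \<omega>\<^sub>1 \<omega>\<^sub>2 (\<lambda>X. (Q X)\<^sup>2 * (q X)\<^sup>2 - ((Q X)\<^sup>2 + (P X)\<^sup>2) * ((q X)\<^sup>2 + (p X)\<^sup>2) / 4)"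
    and "removable \<omega>\<^sub>1 \<omega>\<^sub>2 (\<lambda>X. (Q X)\<^sup>2 * (p X)\<^sup>2 - ((Q X)\<^sup>2 + (P X)\<^sup>2) * ((q X)\<^sup>2 + (p X)\<^sup>2) / 4)"
    and "removable \<omega>\<^sub>1 \<omega>\<^sub>2 (\<lambda>X. (P X)\<^sup>2 * (q X)\<^sup>2 - ((Q X)\<^sup>2 + (P X)\<^sup>2) * ((q X)\<^sup>2 + (p X)\<^sup>2) / 4)"
proof -
  let ?M = "\<lambda>X. Q X * P X * q X * p X"
  have "removable \<omega>\<^sub>1 \<omega>\<^sub>2 (\<lambda>X. \<omega> * (((Q X)\<^sup>2 - (P X)\<^sup>2) * ((q X)\<^sup>2 - (p X)\<^sup>2)) - 4 * \<omega>' * ?M X)"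
    by (rule removable_combine[OF A B, of _ 1 "-1"]) (simp add: algebra_simps)
  moreover have "removable \<omega>\<^sub>1 \<omega>\<^sub>2 (\<lambda>X. \<omega>' * (((Q X)\<^sup>2 - (P X)\<^sup>2) * ((q X)\<^sup>2 - (p X)\<^sup>2)) - 4 * \<omega> * ?M X)"
    by (rule removable_combine[OF C E, of _ 1 "-1"]) (simp add: algebra_simps)
  ultimately have "removable \<omega>\<^sub>1 \<omega>\<^sub>2 (\<lambda>X. 4 * (\<omega>\<^sup>2 - \<omega>'\<^sup>2) * ?M X)"
    by (rule removable_combine[of _ _ _ _ _ \<omega>' "- \<omega>"]) (simp add: algebra_simps power2_eq_square)
  then have "removable \<omega>\<^sub>1 \<omega>\<^sub>2 (\<lambda>X. 1 / (4 * (\<omega>\<^sup>2 - \<omega>'\<^sup>2)) * (4 * (\<omega>\<^sup>2 - \<omega>'\<^sup>2) * ?M X))"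
    by (rule removable_scale)
  then show M: "removable \<omega>\<^sub>1 \<omega>\<^sub>2 ?M"
    by (rule removable_cong) (use assms(3) in simp)
  have 1: "removable \<omega>\<^sub>1 \<omega>\<^sub>2 (\<lambda>X. (Q X)\<^sup>2 * (q X)\<^sup>2 - (P X)\<^sup>2 * (q X)\<^sup>2)"
    by (rule removable_combine[OF A M, of _ "1 / \<omega>" "2 * \<omega>' / \<omega>"]) (use assms(1) in \<open>simp add: field_simps\<close>)
  have 2: "removable \<omega>\<^sub>1 \<omega>\<^sub>2 (\<lambda>X. (Q X)\<^sup>2 * (p X)\<^sup>2 - (P X)\<^sup>2 * (p X)\<^sup>2)"
    by (rule removable_combine[OF B M, of _ "1 / \<omega>" "- 2 * \<omega>' / \<omega>"]) (use assms(1) in \<open>simp add: field_simps\<close>)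
  have 3: "removable \<omega>\<^sub>1 \<omega>\<^sub>2 (\<lambda>X. (Q X)\<^sup>2 * (q X)\<^sup>2 - (Q X)\<^sup>2 * (p X)\<^sup>2)"
    by (rule removable_combine[OF C M, of _ "1 / \<omega>'" "2 * \<omega> / \<omega>'"]) (use assms(2) in \<open>simp add: field_simps\<close>)
  have 4: "removable \<omega>\<^sub>1 \<omega>\<^sub>2 (\<lambda>X. ((Q X)\<^sup>2 * (q X)\<^sup>2 - (P X)\<^sup>2 * (q X)\<^sup>2) + ((Q X)\<^sup>2 * (p X)\<^sup>2 - (P X)\<^sup>2 * (p X)\<^sup>2))"
    by (rule removable.add[OF 1 2])
  show 5: "removable \<omega>\<^sub>1 \<omega>\<^sub>2 (\<lambda>X. (Q X)\<^sup>2 * (q X)\<^sup>2 - ((Q X)\<^sup>2 + (P X)\<^sup>2) * ((q X)\<^sup>2 + (p X)\<^sup>2) / 4)"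
    by (rule removable_combine[OF 4 3, of _ "1 / 4" "1 / 2"]) (simp add: field_simps)
  show "removable \<omega>\<^sub>1 \<omega>\<^sub>2 (\<lambda>X. (Q X)\<^sup>2 * (p X)\<^sup>2 - ((Q X)\<^sup>2 + (P X)\<^sup>2) * ((q X)\<^sup>2 + (p X)\<^sup>2) / 4)"
    by (rule removable_combine[OF 5 3, of _ 1 "-1"]) simp
  show "removable \<omega>\<^sub>1 \<omega>\<^sub>2 (\<lambda>X. (P X)\<^sup>2 * (q X)\<^sup>2 - ((Q X)\<^sup>2 + (P X)\<^sup>2) * ((q X)\<^sup>2 + (p X)\<^sup>2) / 4)"
    by (rule removable_combine[OF 5 1, of _ 1 "-1"]) simp
qed

text \<open>Here all torus averages vanish. \<open>A\<close>, \<open>B\<close>, \<open>C\<close>,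
  \<open>E\<close> are the brackets with \<open>Q\<^sup>3 p\<close>, \<open>Q\<^sup>2 P q\<close>,
  \<open>Q P\<^sup>2 p\<close>, \<open>P\<^sup>3 q\<close>. Eliminating \<open>Q\<^sup>3 q\<close>
  from the first two and \<open>P\<^sup>3 p\<close> from the last two leaves a symmetric system for
  the other two monomials, with diagonal entries \<open>s\<close> and off-diagonal entries
  \<open>u\<close>. Its determinant is the product of the 1:1 and 3:1 divisors, and the solution is
  Cramer's rule.\<close>

lemma cubic_linear_normalization:
  assumes "\<omega>' \<noteq> 0" "\<omega>'\<^sup>2 \<noteq> \<omega>\<^sup>2" "\<omega>'\<^sup>2 \<noteq> 9 * \<omega>\<^sup>2"
    and A: "removable \<omega>\<^sub>1 \<omega>\<^sub>2 (\<lambda>X. \<omega>' * (Q X ^ 3 * q X) - 3 * \<omega> * ((Q X)\<^sup>2 * P X * p X))"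
    and B: "removable \<omega>\<^sub>1 \<omega>\<^sub>2 (\<lambda>X. \<omega> * (Q X ^ 3 * q X) - \<omega>' * ((Q X)\<^sup>2 * P X * p X) - 2 * \<omega> * (Q X * (P X)\<^sup>2 * q X))"
    and C: "removable \<omega>\<^sub>1 \<omega>\<^sub>2 (\<lambda>X. 2 * \<omega> * ((Q X)\<^sup>2 * P X * p X) + \<omega>' * (Q X * (P X)\<^sup>2 * q X) - \<omega> * (P X ^ 3 * p X))"
    and E: "removable \<omega>\<^sub>1 \<omega>\<^sub>2 (\<lambda>X. 3 * \<omega> * (Q X * (P X)\<^sup>2 * q X) - \<omega>' * (P X ^ 3 * p X))"
  shows "removable \<omega>\<^sub>1 \<omega>\<^sub>2 (\<lambda>X. Q X ^ 3 * q X)"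
    and "removable \<omega>\<^sub>1 \<omega>\<^sub>2 (\<lambda>X. (Q X)\<^sup>2 * P X * p X)"
    and "removable \<omega>\<^sub>1 \<omega>\<^sub>2 (\<lambda>X. Q X * (P X)\<^sup>2 * q X)"
proof -
  let ?x = "\<lambda>X. Q X ^ 3 * q X" and ?y = "\<lambda>X. (Q X)\<^sup>2 * P X * p X" and ?z = "\<lambda>X. Q X * (P X)\<^sup>2 * q X"
  define s where "s = \<omega>'\<^sup>2 - 3 * \<omega>\<^sup>2"
  define u where "u = 2 * \<omega> * \<omega>'"
  have det: "s\<^sup>2 - u\<^sup>2 \<noteq> 0"
  proof -
    have "s\<^sup>2 - u\<^sup>2 = (\<omega>'\<^sup>2 - \<omega>\<^sup>2) * (\<omega>'\<^sup>2 - 9 * \<omega>\<^sup>2)"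
      unfolding s_def u_def by algebra
    then show ?thesis using assms(2,3) by simp
  qed
  have 1: "removable \<omega>\<^sub>1 \<omega>\<^sub>2 (\<lambda>X. s * ?y X + u * ?z X)"
    by (rule removable_combine[OF A B, of _ \<omega> "- \<omega>'"]) (simp add: s_def u_def algebra_simps power2_eq_square)
  have 2: "removable \<omega>\<^sub>1 \<omega>\<^sub>2 (\<lambda>X. u * ?y X + s * ?z X)"
    by (rule removable_combine[OF C E, of _ \<omega>' "- \<omega>"]) (simp add: s_def u_def algebra_simps power2_eq_square)
  show y: "removable \<omega>\<^sub>1 \<omega>\<^sub>2 ?y"
  proof (rule removable_combine[OF 1 2])
    fix X
    have "?y X = (s\<^sup>2 - u\<^sup>2) * ?y X / (s\<^sup>2 - u\<^sup>2)" using det by simp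
    also have "\<dots> = s / (s\<^sup>2 - u\<^sup>2) * (s * ?y X + u * ?z X) + - u / (s\<^sup>2 - u\<^sup>2) * (u * ?y X + s * ?z X)"
      by (simp add: add_divide_distrib[symmetric] diff_divide_distrib[symmetric] algebra_simps power2_eq_square)
    finally show "?y X = s / (s\<^sup>2 - u\<^sup>2) * (s * ?y X + u * ?z X) + - u / (s\<^sup>2 - u\<^sup>2) * (u * ?y X + s * ?z X)" .
  qed
  show "removable \<omega>\<^sub>1 \<omega>\<^sub>2 ?z"
  proof (rule removable_combine[OF 1 2])
    fix X
    have "?z X = (s\<^sup>2 - u\<^sup>2) * ?z X / (s\<^sup>2 - u\<^sup>2)" using det by simp
    also have "\<dots> = - u / (s\<^sup>2 - u\<^sup>2) * (s * ?y X + u * ?z X) + s / (s\<^sup>2 - u\<^sup>2) * (u * ?y X + s * ?z X)"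
      by (simp add: add_divide_distrib[symmetric] diff_divide_distrib[symmetric] algebra_simps power2_eq_square)
    finally show "?z X = - u / (s\<^sup>2 - u\<^sup>2) * (s * ?y X + u * ?z X) + s / (s\<^sup>2 - u\<^sup>2) * (u * ?y X + s * ?z X)" .
  qed
  show "removable \<omega>\<^sub>1 \<omega>\<^sub>2 ?x"
    by (rule removable_combine[OF A y, of _ "1 / \<omega>'" "3 * \<omega> / \<omega>'"]) (use assms(1) in \<open>simp add: field_simps\<close>)
qed

text \<open>The Hamiltonian is even in the momenta, so only monomials with this symmetry have to be
  treated. Each is congruent to its torus average modulo removable terms.\<close>

context
  fixes \<omega>\<^sub>1 \<omega>\<^sub>2 :: real
  assumes nonzero: "\<omega>\<^sub>1 \<noteq> 0" "\<omega>\<^sub>2 \<noteq> 0"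
    and nonresonant: "\<omega>\<^sub>1\<^sup>2 \<noteq> \<omega>\<^sub>2\<^sup>2" "\<omega>\<^sub>1\<^sup>2 \<noteq> 9 * \<omega>\<^sub>2\<^sup>2" "\<omega>\<^sub>2\<^sup>2 \<noteq> 9 * \<omega>\<^sub>1\<^sup>2"
begin

lemmas bracket_expansion = oscillator_bracket_axis algebra_simps power2_eq_square power3_eq_cube power4_eq_xxxx

lemma normalize_mode1:
  "removable \<omega>\<^sub>1 \<omega>\<^sub>2 (\<lambda>X. (X $ 1) ^ 4 - 3 / 2 * (action1 X)\<^sup>2)"
  "removable \<omega>\<^sub>1 \<omega>\<^sub>2 (\<lambda>X. (X $ 1)\<^sup>2 * (X $ 3)\<^sup>2 - 1 / 2 * (action1 X)\<^sup>2)"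
proof -
  have "removable \<omega>\<^sub>1 \<omega>\<^sub>2 (\<lambda>X. \<omega>\<^sub>1 * ((X $ 1) ^ 4 - 3 * (X $ 1)\<^sup>2 * (X $ 3)\<^sup>2))"
    by (rule removable_cong[OF removable_monomial[of _ _ 1 1 1 3]]) (simp add: bracket_expansion)
  moreover have "removable \<omega>\<^sub>1 \<omega>\<^sub>2 (\<lambda>X. \<omega>\<^sub>1 * (3 * (X $ 1)\<^sup>2 * (X $ 3)\<^sup>2 - (X $ 3) ^ 4))"
    by (rule removable_cong[OF removable_monomial[of _ _ 1 3 3 3]]) (simp add: bracket_expansion)
  ultimately show
    "removable \<omega>\<^sub>1 \<omega>\<^sub>2 (\<lambda>X. (X $ 1) ^ 4 - 3 / 2 * (action1 X)\<^sup>2)"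
    "removable \<omega>\<^sub>1 \<omega>\<^sub>2 (\<lambda>X. (X $ 1)\<^sup>2 * (X $ 3)\<^sup>2 - 1 / 2 * (action1 X)\<^sup>2)"
    using single_mode_normalization[OF nonzero(1)] by (simp_all add: action1_def power_divide)
qed

lemma normalize_mode2:
  "removable \<omega>\<^sub>1 \<omega>\<^sub>2 (\<lambda>X. (X $ 2) ^ 4 - 3 / 2 * (action2 X)\<^sup>2)"
  "removable \<omega>\<^sub>1 \<omega>\<^sub>2 (\<lambda>X. (X $ 2)\<^sup>2 * (X $ 4)\<^sup>2 - 1 / 2 * (action2 X)\<^sup>2)"
proof -
  have "removable \<omega>\<^sub>1 \<omega>\<^sub>2 (\<lambda>X. \<omega>\<^sub>2 * ((X $ 2) ^ 4 - 3 * (X $ 2)\<^sup>2 * (X $ 4)\<^sup>2))"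
    by (rule removable_cong[OF removable_monomial[of _ _ 2 2 2 4]]) (simp add: bracket_expansion)
  moreover have "removable \<omega>\<^sub>1 \<omega>\<^sub>2 (\<lambda>X. \<omega>\<^sub>2 * (3 * (X $ 2)\<^sup>2 * (X $ 4)\<^sup>2 - (X $ 4) ^ 4))"
    by (rule removable_cong[OF removable_monomial[of _ _ 2 4 4 4]]) (simp add: bracket_expansion)
  ultimately show
    "removable \<omega>\<^sub>1 \<omega>\<^sub>2 (\<lambda>X. (X $ 2) ^ 4 - 3 / 2 * (action2 X)\<^sup>2)"
    "removable \<omega>\<^sub>1 \<omega>\<^sub>2 (\<lambda>X. (X $ 2)\<^sup>2 * (X $ 4)\<^sup>2 - 1 / 2 * (action2 X)\<^sup>2)"
    using single_mode_normalization[OF nonzero(2)] by (simp_all add: action2_def power_divide)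
qed

lemma normalize_mixed:
  "removable \<omega>\<^sub>1 \<omega>\<^sub>2 (\<lambda>X. X $ 1 * X $ 3 * X $ 2 * X $ 4)"
  "removable \<omega>\<^sub>1 \<omega>\<^sub>2 (\<lambda>X. (X $ 1)\<^sup>2 * (X $ 2)\<^sup>2 - action1 X * action2 X)"
  "removable \<omega>\<^sub>1 \<omega>\<^sub>2 (\<lambda>X. (X $ 1)\<^sup>2 * (X $ 4)\<^sup>2 - action1 X * action2 X)"
  "removable \<omega>\<^sub>1 \<omega>\<^sub>2 (\<lambda>X. (X $ 3)\<^sup>2 * (X $ 2)\<^sup>2 - action1 X * action2 X)"
proof -
  have A: "removable \<omega>\<^sub>1 \<omega>\<^sub>2 (\<lambda>X. \<omega>\<^sub>1 * ((X $ 1)\<^sup>2 - (X $ 3)\<^sup>2) * (X $ 2)\<^sup>2 - 2 * \<omega>\<^sub>2 * (X $ 1 * X $ 3 * X $ 2 * X $ 4))"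
    by (rule removable_cong[OF removable_monomial[of _ _ 1 3 2 2]]) (simp add: bracket_expansion)
  have B: "removable \<omega>\<^sub>1 \<omega>\<^sub>2 (\<lambda>X. \<omega>\<^sub>1 * ((X $ 1)\<^sup>2 - (X $ 3)\<^sup>2) * (X $ 4)\<^sup>2 + 2 * \<omega>\<^sub>2 * (X $ 1 * X $ 3 * X $ 2 * X $ 4))"
    by (rule removable_cong[OF removable_monomial[of _ _ 1 3 4 4]]) (simp add: bracket_expansion)
  have C: "removable \<omega>\<^sub>1 \<omega>\<^sub>2 (\<lambda>X. \<omega>\<^sub>2 * (X $ 1)\<^sup>2 * ((X $ 2)\<^sup>2 - (X $ 4)\<^sup>2) - 2 * \<omega>\<^sub>1 * (X $ 1 * X $ 3 * X $ 2 * X $ 4))"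
    by (rule removable_cong[OF removable_monomial[of _ _ 1 1 2 4]]) (simp add: bracket_expansion)
  have E: "removable \<omega>\<^sub>1 \<omega>\<^sub>2 (\<lambda>X. \<omega>\<^sub>2 * (X $ 3)\<^sup>2 * ((X $ 2)\<^sup>2 - (X $ 4)\<^sup>2) + 2 * \<omega>\<^sub>1 * (X $ 1 * X $ 3 * X $ 2 * X $ 4))"
    by (rule removable_cong[OF removable_monomial[of _ _ 3 3 2 4]]) (simp add: bracket_expansion)
  note * = mixed_mode_normalization[OF nonzero nonresonant(1) A B C E]
  show "removable \<omega>\<^sub>1 \<omega>\<^sub>2 (\<lambda>X. X $ 1 * X $ 3 * X $ 2 * X $ 4)" by (rule *(1))
  show
    "removable \<omega>\<^sub>1 \<omega>\<^sub>2 (\<lambda>X. (X $ 1)\<^sup>2 * (X $ 2)\<^sup>2 - action1 X * action2 X)"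
    "removable \<omega>\<^sub>1 \<omega>\<^sub>2 (\<lambda>X. (X $ 1)\<^sup>2 * (X $ 4)\<^sup>2 - action1 X * action2 X)"
    "removable \<omega>\<^sub>1 \<omega>\<^sub>2 (\<lambda>X. (X $ 3)\<^sup>2 * (X $ 2)\<^sup>2 - action1 X * action2 X)"
    using *(2-4) by (simp_all add: action1_def action2_def)
qed

lemma normalize_cubic_linear12:
  "removable \<omega>\<^sub>1 \<omega>\<^sub>2 (\<lambda>X. (X $ 1) ^ 3 * X $ 2)"
  "removable \<omega>\<^sub>1 \<omega>\<^sub>2 (\<lambda>X. (X $ 1)\<^sup>2 * X $ 3 * X $ 4)"
  "removable \<omega>\<^sub>1 \<omega>\<^sub>2 (\<lambda>X. X $ 1 * (X $ 3)\<^sup>2 * X $ 2)"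
proof -
  have A: "removable \<omega>\<^sub>1 \<omega>\<^sub>2 (\<lambda>X. \<omega>\<^sub>2 * ((X $ 1) ^ 3 * X $ 2) - 3 * \<omega>\<^sub>1 * ((X $ 1)\<^sup>2 * X $ 3 * X $ 4))"
    by (rule removable_cong[OF removable_monomial[of _ _ 1 1 1 4]]) (simp add: bracket_expansion)
  have B: "removable \<omega>\<^sub>1 \<omega>\<^sub>2 (\<lambda>X. \<omega>\<^sub>1 * ((X $ 1) ^ 3 * X $ 2) - \<omega>\<^sub>2 * ((X $ 1)\<^sup>2 * X $ 3 * X $ 4) - 2 * \<omega>\<^sub>1 * (X $ 1 * (X $ 3)\<^sup>2 * X $ 2))"
    by (rule removable_cong[OF removable_monomial[of _ _ 1 1 3 2]]) (simp add: bracket_expansion)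
  have C: "removable \<omega>\<^sub>1 \<omega>\<^sub>2 (\<lambda>X. 2 * \<omega>\<^sub>1 * ((X $ 1)\<^sup>2 * X $ 3 * X $ 4) + \<omega>\<^sub>2 * (X $ 1 * (X $ 3)\<^sup>2 * X $ 2) - \<omega>\<^sub>1 * ((X $ 3) ^ 3 * X $ 4))"
    by (rule removable_cong[OF removable_monomial[of _ _ 1 3 3 4]]) (simp add: bracket_expansion)
  have E: "removable \<omega>\<^sub>1 \<omega>\<^sub>2 (\<lambda>X. 3 * \<omega>\<^sub>1 * (X $ 1 * (X $ 3)\<^sup>2 * X $ 2) - \<omega>\<^sub>2 * ((X $ 3) ^ 3 * X $ 4))"
    by (rule removable_cong[OF removable_monomial[of _ _ 3 3 3 2]]) (simp add: bracket_expansion)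
  show "removable \<omega>\<^sub>1 \<omega>\<^sub>2 (\<lambda>X. (X $ 1) ^ 3 * X $ 2)"
    "removable \<omega>\<^sub>1 \<omega>\<^sub>2 (\<lambda>X. (X $ 1)\<^sup>2 * X $ 3 * X $ 4)"
    "removable \<omega>\<^sub>1 \<omega>\<^sub>2 (\<lambda>X. X $ 1 * (X $ 3)\<^sup>2 * X $ 2)"
    by (rule cubic_linear_normalization[OF nonzero(2) nonresonant(1)[symmetric] nonresonant(3) A B C E])+
qed

lemma normalize_cubic_linear21:
  "removable \<omega>\<^sub>1 \<omega>\<^sub>2 (\<lambda>X. (X $ 2) ^ 3 * X $ 1)"
  "removable \<omega>\<^sub>1 \<omega>\<^sub>2 (\<lambda>X. (X $ 2)\<^sup>2 * X $ 4 * X $ 3)"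
  "removable \<omega>\<^sub>1 \<omega>\<^sub>2 (\<lambda>X. X $ 2 * (X $ 4)\<^sup>2 * X $ 1)"
proof -
  have A: "removable \<omega>\<^sub>1 \<omega>\<^sub>2 (\<lambda>X. \<omega>\<^sub>1 * ((X $ 2) ^ 3 * X $ 1) - 3 * \<omega>\<^sub>2 * ((X $ 2)\<^sup>2 * X $ 4 * X $ 3))"
    by (rule removable_cong[OF removable_monomial[of _ _ 2 2 2 3]]) (simp add: bracket_expansion)
  have B: "removable \<omega>\<^sub>1 \<omega>\<^sub>2 (\<lambda>X. \<omega>\<^sub>2 * ((X $ 2) ^ 3 * X $ 1) - \<omega>\<^sub>1 * ((X $ 2)\<^sup>2 * X $ 4 * X $ 3) - 2 * \<omega>\<^sub>2 * (X $ 2 * (X $ 4)\<^sup>2 * X $ 1))"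
    by (rule removable_cong[OF removable_monomial[of _ _ 2 2 4 1]]) (simp add: bracket_expansion)
  have C: "removable \<omega>\<^sub>1 \<omega>\<^sub>2 (\<lambda>X. 2 * \<omega>\<^sub>2 * ((X $ 2)\<^sup>2 * X $ 4 * X $ 3) + \<omega>\<^sub>1 * (X $ 2 * (X $ 4)\<^sup>2 * X $ 1) - \<omega>\<^sub>2 * ((X $ 4) ^ 3 * X $ 3))"
    by (rule removable_cong[OF removable_monomial[of _ _ 2 4 4 3]]) (simp add: bracket_expansion)
  have E: "removable \<omega>\<^sub>1 \<omega>\<^sub>2 (\<lambda>X. 3 * \<omega>\<^sub>2 * (X $ 2 * (X $ 4)\<^sup>2 * X $ 1) - \<omega>\<^sub>1 * ((X $ 4) ^ 3 * X $ 3))"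
    by (rule removable_cong[OF removable_monomial[of _ _ 4 4 4 1]]) (simp add: bracket_expansion)
  show "removable \<omega>\<^sub>1 \<omega>\<^sub>2 (\<lambda>X. (X $ 2) ^ 3 * X $ 1)"
    "removable \<omega>\<^sub>1 \<omega>\<^sub>2 (\<lambda>X. (X $ 2)\<^sup>2 * X $ 4 * X $ 3)"
    "removable \<omega>\<^sub>1 \<omega>\<^sub>2 (\<lambda>X. X $ 2 * (X $ 4)\<^sup>2 * X $ 1)"
    by (rule cubic_linear_normalization[OF nonzero(1) nonresonant(1,2) A B C E])+
qed

end

section \<open>Expansion of the Hamiltonian\<close>

text \<open>One-variable asymptotics are stated on the punctured filter \<open>at 0\<close>; the
  condition \<open>f 0 = 0\<close> supplies the missing point for \<open>nhds 0\<close>.\<close>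

lemma O_norm_of_univariate:
  fixes f :: "real \<Rightarrow> real"
  assumes "f \<in> O[at 0](\<lambda>x. x ^ n)" "f 0 = 0"
  shows "(\<lambda>X. f (X $ i)) \<in> O_norm n"
proof -
  obtain c where c: "c > 0" "\<forall>\<^sub>F x in at 0. norm (f x) \<le> c * norm (x ^ n)"
    using assms(1) by (rule landau_o.bigE)
  then have "\<forall>\<^sub>F x in nhds 0. norm (f x) \<le> c * norm (x ^ n)"
    using assms(2) by (simp add: eventually_nhds_conv_at)
  moreover have "filterlim (\<lambda>X :: real^4. X $ i) (nhds (0 $ i)) (nhds 0)"
    by (intro tendsto_vec_nth filterlim_ident)
  ultimately have "\<forall>\<^sub>F X in nhds (0 :: real^4). norm (f (X $ i)) \<le> c * norm ((X $ i) ^ n)"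
    by (auto dest: eventually_compose_filterlim)
  then have "(\<lambda>X. f (X $ i)) \<in> O[nhds 0](\<lambda>X. (X $ i) ^ n)" by (rule bigoI)
  also have "(\<lambda>X :: real^4. (X $ i) ^ n) \<in> O_norm n"
    using formlikeD(1)[OF formlike_power[OF formlike_component]] by simp
  finally show ?thesis .
qed

text \<open>Order three suffices because this factor is multiplied by a squared momentum. With s the
  squared sine, the denominator is \<open>\<beta>\<^sup>2 + (1 - \<beta>\<^sup>2) * s\<close>; its
  reciprocal is two terms of a geometric series with exact remainder, and exchanging s for
  \<open>x\<^sup>2\<close> costs the second error term.\<close>

lemma inverse_metric_expansion:
  fixes \<beta> :: real
  assumes "\<beta> > 0"
  shows "(\<lambda>x. 1 / (\<beta>\<^sup>2 * (cos x)\<^sup>2 + (sin x)\<^sup>2) - (1 / \<beta>\<^sup>2 - (1 - \<beta>\<^sup>2) / \<beta> ^ 4 * x\<^sup>2)) \<in> O[at 0](\<lambda>x. x ^ 3)"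
proof -
  have 1: "(\<lambda>x. (1 - \<beta>\<^sup>2)\<^sup>2 / \<beta> ^ 4 * ((sin x) ^ 4 / (\<beta>\<^sup>2 * (cos x)\<^sup>2 + (sin x)\<^sup>2))) \<in> O[at 0](\<lambda>x. x ^ 3)"
    by (rule cmult_in_bigo_iff[THEN iffD2, OF disjI2]) (use assms in real_asymp)
  have 2: "(\<lambda>x. (1 - \<beta>\<^sup>2) / \<beta> ^ 4 * (x\<^sup>2 - (sin x)\<^sup>2)) \<in> O[at 0](\<lambda>x. x ^ 3)"
    by (rule cmult_in_bigo_iff[THEN iffD2, OF disjI2]) real_asymp
  have "1 / (\<beta>\<^sup>2 * (cos x)\<^sup>2 + (sin x)\<^sup>2) - (1 / \<beta>\<^sup>2 - (1 - \<beta>\<^sup>2) / \<beta> ^ 4 * x\<^sup>2) =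
      (1 - \<beta>\<^sup>2)\<^sup>2 / \<beta> ^ 4 * ((sin x) ^ 4 / (\<beta>\<^sup>2 * (cos x)\<^sup>2 + (sin x)\<^sup>2)) +
      (1 - \<beta>\<^sup>2) / \<beta> ^ 4 * (x\<^sup>2 - (sin x)\<^sup>2)" for x
  proof -
    define s where "s = (sin x)\<^sup>2"
    have D: "\<beta>\<^sup>2 * (cos x)\<^sup>2 + (sin x)\<^sup>2 = \<beta>\<^sup>2 + (1 - \<beta>\<^sup>2) * s"
      unfolding cos_squared_eq s_def by (simp add: algebra_simps)
    have "0 < \<beta>\<^sup>2 * (cos x)\<^sup>2 + (sin x)\<^sup>2"
    proof (cases "sin x = 0")
      case True
      then show ?thesis using assms sin_cos_squared_add[of x] by simp
    next
      case False
      then show ?thesis by (simp add: add_nonneg_pos)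
    qed
    then have nz: "\<beta>\<^sup>2 + (1 - \<beta>\<^sup>2) * s \<noteq> 0" unfolding D by simp
    have pow: "(sin x) ^ 4 = s\<^sup>2" "\<beta> ^ 4 = (\<beta>\<^sup>2)\<^sup>2" by (simp_all add: s_def flip: power_mult)
    have key: "1 / d - (1 / b - (1 - b) / b\<^sup>2 * y) = (1 - b)\<^sup>2 / b\<^sup>2 * (s\<^sup>2 / d) + (1 - b) / b\<^sup>2 * (y - s)"
      if "d = b + (1 - b) * s" "d \<noteq> 0" "b \<noteq> 0" for b d y :: real
    proof -
      have "1 / d - 1 / b = (1 - b)\<^sup>2 / b\<^sup>2 * (s\<^sup>2 / d) - (1 - b) / b\<^sup>2 * s"
        using that(2,3) by (simp add: divide_simps) (simp add: that(1) algebra_simps power2_eq_square)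
      then show ?thesis by (simp add: right_diff_distrib)
    qed
    show ?thesis
      unfolding D unfolding pow s_def[symmetric] by (rule key[OF refl nz]) (use assms in simp)
  qed
  with sum_in_bigo(1)[OF 1 2] show ?thesis by simp
qed

definition hamiltonian_quadratic :: "real \<Rightarrow> real \<Rightarrow> real \<Rightarrow> real^4 \<Rightarrow> real" where
  "hamiltonian_quadratic \<alpha> \<beta> \<delta> x =
     ((x $ 3)\<^sup>2 / (\<alpha> * \<beta>\<^sup>2) + (x $ 4)\<^sup>2 + (x $ 2 - \<beta> * x $ 1)\<^sup>2 + \<delta> * (x $ 1)\<^sup>2) / 2"

text \<open>In the last coefficient, 1/8 is half the square of \<open>x\<^sup>2 / 2\<close>,
  \<open>\<delta> / 24\<close> comes from the quartic term of the cosine, and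
  \<open>\<beta>\<^sup>2 / 6\<close> from multiplying the linear and cubic terms of
  \<open>\<beta> * sin x\<close>.\<close>

definition hamiltonian_quartic :: "real \<Rightarrow> real \<Rightarrow> real \<Rightarrow> real^4 \<Rightarrow> real" where
  "hamiltonian_quartic \<alpha> \<beta> \<delta> x =
     - (1 - \<beta>\<^sup>2) / (2 * \<alpha> * \<beta> ^ 4) * ((x $ 3)\<^sup>2 * (x $ 1)\<^sup>2) + \<beta> / 6 * (x $ 2 * (x $ 1) ^ 3)
     + (1 / 8 - \<beta>\<^sup>2 / 6 - \<delta> / 24) * (x $ 1) ^ 4"

lemma hamiltonian_expansion:
  assumes "\<alpha> > 0" "\<beta> > 0"
  shows "(\<lambda>x. hamiltonian \<alpha> \<beta> \<delta> x - hamiltonian \<alpha> \<beta> \<delta> 0 - hamiltonian_quadratic \<alpha> \<beta> \<delta> x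
            - hamiltonian_quartic \<alpha> \<beta> \<delta> x) \<in> O_norm 5"
proof -
  define g where "g x = 1 / (\<beta>\<^sup>2 * (cos x)\<^sup>2 + (sin x)\<^sup>2) - (1 / \<beta>\<^sup>2 - (1 - \<beta>\<^sup>2) / \<beta> ^ 4 * x\<^sup>2)" for x :: real
  define \<sigma> where "\<sigma> x = sin x - (x - x ^ 3 / 6)" for x :: real
  define \<tau> where "\<tau> x = cos x - (1 - x\<^sup>2 / 2 + x ^ 4 / 24)" for x :: real
  have g: "(\<lambda>X. g (X $ 1)) \<in> O_norm 3"
    using inverse_metric_expansion[OF assms(2)]
    by (intro O_norm_of_univariate) (simp_all add: g_def[abs_def])
  have "\<sigma> \<in> O[at 0](\<lambda>x. x ^ 5)" unfolding \<sigma>_def[abs_def] by real_asymp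
  then have \<sigma>: "(\<lambda>X. \<sigma> (X $ 1)) \<in> O_norm 5" by (rule O_norm_of_univariate) (simp add: \<sigma>_def)
  have "\<tau> \<in> O[at 0](\<lambda>x. x ^ 5)" unfolding \<tau>_def[abs_def] by real_asymp
  then have \<tau>: "(\<lambda>X. \<tau> (X $ 1)) \<in> O_norm 5" by (rule O_norm_of_univariate) (simp add: \<tau>_def)
  have mono: "(\<lambda>X :: real^4. (X $ i) ^ n) \<in> O_norm n" for i n
    using formlikeD(1)[OF formlike_power[OF formlike_component]] by simp
  have mono0: "(\<lambda>X :: real^4. (X $ i) ^ n) \<in> O_norm 0" for i n
    using O_norm_antimono[OF mono, of 0] by blast
  have comp0: "(\<lambda>X :: real^4. X $ i) \<in> O_norm 0" for i using mono0[of i 1] by simp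
  have scale0: "(\<lambda>X. c * f X) \<in> O_norm n" if "f \<in> O_norm n" for c f n
    using O_norm_mult[OF O_norm_const that, of c] by simp
  have G: "(\<lambda>X. g (X $ 1) * (1 / (2 * \<alpha>) * (X $ 3)\<^sup>2)) \<in> O_norm (3 + 2)"
    by (rule O_norm_mult[OF g scale0[OF mono]])
  have S: "(\<lambda>X. \<sigma> (X $ 1) * ((\<beta>\<^sup>2 / 2) * \<sigma> (X $ 1) + ((-\<beta>) * X $ 2 + (\<beta>\<^sup>2 * X $ 1 + (-\<beta>\<^sup>2 / 6) * (X $ 1) ^ 3)))) \<in> O_norm (5 + 0)"
    by (rule O_norm_mult[OF \<sigma>], intro O_norm_add scale0 O_norm_antimono[OF \<sigma>] comp0 mono0) simp
  have T: "(\<lambda>X. \<tau> (X $ 1) * ((1 / 2) * \<tau> (X $ 1) + (- \<delta> + ((-1 / 2) * (X $ 1)\<^sup>2 + (1 / 24) * (X $ 1) ^ 4)))) \<in> O_norm (5 + 0)"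
    by (rule O_norm_mult[OF \<tau>], intro O_norm_add scale0 O_norm_antimono[OF \<tau>] O_norm_const mono0) simp
  have deg: "3 + 2 = (5 :: nat)" "5 + 0 = (5 :: nat)" by simp_all
  \<comment> \<open>These are the terms of degree six and eight left over when the truncated sine
    and cosine series are squared.\<close>
  have P: "(\<lambda>X :: real^4. (\<beta>\<^sup>2 / 72 - 1 / 48) * (X $ 1) ^ 6 + 1 / 1152 * (X $ 1) ^ 8) \<in> O_norm 5"
    by (intro O_norm_add scale0 O_norm_antimono[OF mono]) simp_all
  have "hamiltonian \<alpha> \<beta> \<delta> X - hamiltonian \<alpha> \<beta> \<delta> 0 - hamiltonian_quadratic \<alpha> \<beta> \<delta> X
      - hamiltonian_quartic \<alpha> \<beta> \<delta> X =
      g (X $ 1) * (1 / (2 * \<alpha>) * (X $ 3)\<^sup>2)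
      + \<sigma> (X $ 1) * ((\<beta>\<^sup>2 / 2) * \<sigma> (X $ 1) + ((-\<beta>) * X $ 2 + (\<beta>\<^sup>2 * X $ 1 + (-\<beta>\<^sup>2 / 6) * (X $ 1) ^ 3)))
      + \<tau> (X $ 1) * ((1 / 2) * \<tau> (X $ 1) + (- \<delta> + ((-1 / 2) * (X $ 1)\<^sup>2 + (1 / 24) * (X $ 1) ^ 4)))
      + ((\<beta>\<^sup>2 / 72 - 1 / 48) * (X $ 1) ^ 6 + 1 / 1152 * (X $ 1) ^ 8)" for X
  proof -
    have kinetic: "p\<^sup>2 / (\<alpha> * (\<beta>\<^sup>2 * (cos x)\<^sup>2 + (sin x)\<^sup>2)) / 2 =
        g x * (1 / (2 * \<alpha>) * p\<^sup>2) + p\<^sup>2 / (\<alpha> * \<beta>\<^sup>2) / 2 + - (1 - \<beta>\<^sup>2) / (2 * \<alpha> * \<beta> ^ 4) * (p\<^sup>2 * x\<^sup>2)" for p x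
    proof -
      have "1 / (\<beta>\<^sup>2 * (cos x)\<^sup>2 + (sin x)\<^sup>2) = g x + (1 / \<beta>\<^sup>2 - (1 - \<beta>\<^sup>2) / \<beta> ^ 4 * x\<^sup>2)"
        by (simp add: g_def)
      then have "p\<^sup>2 / (\<alpha> * (\<beta>\<^sup>2 * (cos x)\<^sup>2 + (sin x)\<^sup>2)) / 2 =
          p\<^sup>2 / (2 * \<alpha>) * (g x + (1 / \<beta>\<^sup>2 - (1 - \<beta>\<^sup>2) / \<beta> ^ 4 * x\<^sup>2))"
        by (metis (no_types, opaque_lifting) divide_divide_eq_left mult.commute times_divide_eq_right mult.right_neutral)
      also have "\<dots> = g x * (1 / (2 * \<alpha>) * p\<^sup>2) + p\<^sup>2 / (\<alpha> * \<beta>\<^sup>2) / 2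
          + - (1 - \<beta>\<^sup>2) / (2 * \<alpha> * \<beta> ^ 4) * (p\<^sup>2 * x\<^sup>2)"
        using assms by (simp add: field_simps eval_nat_numeral)
      finally show ?thesis .
    qed
    have spring1: "(y - \<beta> * sin x)\<^sup>2 / 2 = (y - \<beta> * x)\<^sup>2 / 2
        + \<sigma> x * ((\<beta>\<^sup>2 / 2) * \<sigma> x + ((-\<beta>) * y + (\<beta>\<^sup>2 * x + (-\<beta>\<^sup>2 / 6) * x ^ 3)))
        + \<beta> / 6 * (y * x ^ 3) - \<beta>\<^sup>2 / 6 * x ^ 4 + \<beta>\<^sup>2 / 72 * x ^ 6" for x y
    proof -
      have e: "sin x = \<sigma> x + (x - x ^ 3 / 6)" by (simp add: \<sigma>_def)
      show ?thesis unfolding e by (simp add: field_simps eval_nat_numeral)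
    qed
    have spring2: "(\<delta> + 1 - cos x)\<^sup>2 / 2 = \<delta>\<^sup>2 / 2 + \<delta> * x\<^sup>2 / 2
        + \<tau> x * ((1 / 2) * \<tau> x + (- \<delta> + ((-1 / 2) * x\<^sup>2 + (1 / 24) * x ^ 4)))
        + (1 / 8 - \<delta> / 24) * x ^ 4 - 1 / 48 * x ^ 6 + 1 / 1152 * x ^ 8" for x
    proof -
      have e: "cos x = \<tau> x + (1 - x\<^sup>2 / 2 + x ^ 4 / 24)" by (simp add: \<tau>_def)
      show ?thesis unfolding e by (simp add: field_simps eval_nat_numeral)
    qed
    have zero: "hamiltonian \<alpha> \<beta> \<delta> 0 = \<delta>\<^sup>2 / 2" by (simp add: hamiltonian_def)
    show ?thesis
      unfolding zero unfolding hamiltonian_def hamiltonian_quadratic_def hamiltonian_quartic_def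
        add_divide_distrib[of _ _ 2] kinetic spring1 spring2
      by (simp only: left_diff_distrib distrib_right)
  qed
  moreover have "(\<lambda>X. g (X $ 1) * (1 / (2 * \<alpha>) * (X $ 3)\<^sup>2)
      + \<sigma> (X $ 1) * ((\<beta>\<^sup>2 / 2) * \<sigma> (X $ 1) + ((-\<beta>) * X $ 2 + (\<beta>\<^sup>2 * X $ 1 + (-\<beta>\<^sup>2 / 6) * (X $ 1) ^ 3)))
      + \<tau> (X $ 1) * ((1 / 2) * \<tau> (X $ 1) + (- \<delta> + ((-1 / 2) * (X $ 1)\<^sup>2 + (1 / 24) * (X $ 1) ^ 4)))
      + ((\<beta>\<^sup>2 / 72 - 1 / 48) * (X $ 1) ^ 6 + 1 / 1152 * (X $ 1) ^ 8)) \<in> O_norm 5"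
    by (rule O_norm_add[OF O_norm_add[OF O_norm_add[OF G[unfolded deg] S[unfolded deg]] T[unfolded deg]] P])
  ultimately show ?thesis by presburger
qed

text \<open>The transformation is \<open>L \<circ> S\<close>: \<open>L\<close> diagonalises
  \<open>K2\<close>, and \<open>S\<close> is chosen so that it changes the quadratic part by
  \<open>N4\<close> minus the transformed \<open>K4\<close>. That change cancels the quartic part
  present and leaves \<open>N4\<close>, while the effect of \<open>S\<close> on the quartic part
  itself has order six.\<close>

lemma removable_imp_birkhoff_transformation:
  assumes L: "polynomial_canonical L" "L 0 = 0" "(\<lambda>X. norm (L X)) \<in> O_norm 1"
    and H: "(\<lambda>x. H x - H 0 - K2 x - K4 x) \<in> O_norm 5"
    and K2: "\<And>X. K2 (L X) = quadratic_part \<omega>\<^sub>1 \<omega>\<^sub>2 X"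
    and K4: "formlike 4 (\<lambda>X. K4 (L X))"
    and N4: "removable \<omega>\<^sub>1 \<omega>\<^sub>2 (\<lambda>X. N4 X - K4 (L X))"
  shows "\<exists>U \<phi>. open U \<and> 0 \<in> U \<and> \<phi> 0 = 0 \<and> analytic_canonical_on U \<phi> \<and>
    (\<lambda>X. H (\<phi> X) - (H 0 + (quadratic_part \<omega>\<^sub>1 \<omega>\<^sub>2 X + N4 X))) \<in> O[at 0](\<lambda>X. norm X ^ 5)"
proof -
  obtain S where S: "polynomial_canonical S" "near_identity S" "S 0 = 0"
    "(\<lambda>X. quadratic_part \<omega>\<^sub>1 \<omega>\<^sub>2 (S X) - quadratic_part \<omega>\<^sub>1 \<omega>\<^sub>2 X - (N4 X - K4 (L X))) \<in> O_norm 5"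
    using removable_imp_canonical[OF N4] by blast
  have 1: "(\<lambda>X. K4 (L (S X)) - K4 (L X)) \<in> O_norm 5"
    using O_norm_antimono[OF formlikeD(2)[OF K4 S(2)], of 5] by simp
  have 2: "(\<lambda>X. H (L (S X)) - H 0 - K2 (L (S X)) - K4 (L (S X))) \<in> O_norm 5"
    by (rule O_norm_compose[OF O_norm_compose[OF H L(3)] near_identity_norm[OF S(2)]])
  have "(\<lambda>X. (H (L (S X)) - H 0 - K2 (L (S X)) - K4 (L (S X))) + (K4 (L (S X)) - K4 (L X))
      + (quadratic_part \<omega>\<^sub>1 \<omega>\<^sub>2 (S X) - quadratic_part \<omega>\<^sub>1 \<omega>\<^sub>2 X - (N4 X - K4 (L X)))) \<in> O_norm 5"
    by (rule O_norm_add[OF O_norm_add[OF 2 1] S(4)])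
  then have "(\<lambda>X. H ((L \<circ> S) X) - (H 0 + (quadratic_part \<omega>\<^sub>1 \<omega>\<^sub>2 X + N4 X))) \<in> O_norm 5"
    by (simp add: K2 algebra_simps)
  then have "(\<lambda>X. H ((L \<circ> S) X) - (H 0 + (quadratic_part \<omega>\<^sub>1 \<omega>\<^sub>2 X + N4 X))) \<in> O[at 0](\<lambda>X. norm X ^ 5)"
    by (rule landau_o.big.filter_mono[rotated]) (simp add: at_within_def)
  moreover have "analytic_canonical_on UNIV (L \<circ> S)"
    by (intro polynomial_canonical_imp_analytic_canonical polynomial_canonical_compose L S)
  ultimately show ?thesis
    using L(2) S(3) by (intro exI[of _ UNIV] exI[of _ "L \<circ> S"]) simp
qed

section \<open>Normal forms that are polynomials in the actions\<close>

lemma quadratic_part_actions: "quadratic_part \<omega>\<^sub>1 \<omega>\<^sub>2 X = \<omega>\<^sub>1 * action1 X + \<omega>\<^sub>2 * action2 X"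
  by (simp add: quadratic_part_def action1_def action2_def)

lemma action_derivatives:
  "(action1 has_derivative (\<lambda>v. X $ 1 * v $ 1 + X $ 3 * v $ 3)) (at X)"
  "(action2 has_derivative (\<lambda>v. X $ 2 * v $ 2 + X $ 4 * v $ 4)) (at X)"
proof -
  have "((\<lambda>X :: real^4. 1 / 2 * (X $ i * X $ i + X $ j * X $ j)) has_derivative
      (\<lambda>v. X $ i * v $ i + X $ j * v $ j)) (at X)" for i j
    by (rule derivative_eq_intros bounded_linear_imp_has_derivative[OF bounded_linear_vec_nth] refl)+
       (simp add: algebra_simps)
  then show "(action1 has_derivative (\<lambda>v. X $ 1 * v $ 1 + X $ 3 * v $ 3)) (at X)"
    "(action2 has_derivative (\<lambda>v. X $ 2 * v $ 2 + X $ 4 * v $ 4)) (at X)"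
    unfolding action1_def[abs_def] action2_def[abs_def] power2_eq_square by simp_all
qed

text \<open>The two actions commute, so anything whose differential is a combination of theirs
  commutes with the quadratic part. \<open>A\<close> and \<open>B\<close> belong to the single point
  \<open>X\<close>, which lets the lemma cover nonlinear functions of the actions.\<close>

lemma poisson_bracket_quadratic_part_eq_0:
  assumes "(f has_derivative (\<lambda>v. A * (X $ 1 * v $ 1 + X $ 3 * v $ 3) + B * (X $ 2 * v $ 2 + X $ 4 * v $ 4))) (at X)"
  shows "poisson_bracket f (quadratic_part \<omega>\<^sub>1 \<omega>\<^sub>2) X = 0"
proof -
  have "(quadratic_part \<omega>\<^sub>1 \<omega>\<^sub>2 has_derivative
      (\<lambda>v. \<omega>\<^sub>1 * (X $ 1 * v $ 1 + X $ 3 * v $ 3) + \<omega>\<^sub>2 * (X $ 2 * v $ 2 + X $ 4 * v $ 4))) (at X)"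
    unfolding quadratic_part_actions[abs_def]
    by (intro has_derivative_add has_derivative_mult_right action_derivatives)
  note D = frechet_derivative_at[OF this, symmetric] frechet_derivative_at[OF assms, symmetric]
  show ?thesis
    unfolding poisson_bracket_def partial_deriv_def D by (simp add: axis_def algebra_simps)
qed

lemma homogeneous_polynomial_scale:
  "homogeneous_polynomial d f \<Longrightarrow> homogeneous_polynomial d (\<lambda>x. c * f x)"
  using homogeneous_polynomial_mult[OF homogeneous_polynomial_const, of d f c] by simp

lemma homogeneous_actions:
  "homogeneous_polynomial 2 action1" "homogeneous_polynomial 2 action2"
proof -
  have "homogeneous_polynomial 2 (\<lambda>X :: real^4. (1 / 2) * (X $ i * X $ i + X $ j * X $ j))" for i j
    using homogeneous_polynomial_mult[OF homogeneous_polynomial_component homogeneous_polynomial_component]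
    by (intro homogeneous_polynomial_scale homogeneous_polynomial_add) (simp_all add: numeral_2_eq_2)
  then show "homogeneous_polynomial 2 action1" "homogeneous_polynomial 2 action2"
    by (simp_all add: action1_def[abs_def] action2_def[abs_def] power2_eq_square)
qed

lemma birkhoff_normal_form_of_actions:
  assumes "\<exists>U \<phi>. open U \<and> 0 \<in> U \<and> \<phi> 0 = 0 \<and> analytic_canonical_on U \<phi> \<and>
    (\<lambda>X. H (\<phi> X) - (H 0 + (quadratic_part \<omega>\<^sub>1 \<omega>\<^sub>2 X +
       (a * (action1 X)\<^sup>2 + b * action1 X * action2 X + c * (action2 X)\<^sup>2)))) \<in> O[at 0](\<lambda>X. norm X ^ 5)"
  shows "birkhoff_normal_form 4 \<omega>\<^sub>1 \<omega>\<^sub>2 H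
           (\<lambda>X. \<omega>\<^sub>1 * action1 X + \<omega>\<^sub>2 * action2 X +
                a * (action1 X)\<^sup>2 + b * action1 X * action2 X + c * (action2 X)\<^sup>2)"
proof -
  define N4 where "N4 X = a * (action1 X)\<^sup>2 + b * action1 X * action2 X + c * (action2 X)\<^sup>2" for X
  define h where "h k = (if k = 2 then quadratic_part \<omega>\<^sub>1 \<omega>\<^sub>2 else if k = 4 then N4 else (\<lambda>_. 0))" for k :: nat
  have hom2: "homogeneous_polynomial 2 (quadratic_part \<omega>\<^sub>1 \<omega>\<^sub>2)"
    unfolding quadratic_part_actions[abs_def]
    by (intro homogeneous_polynomial_add homogeneous_polynomial_scale homogeneous_actions)
  have hom4: "homogeneous_polynomial 4 N4"
  proof -
    have "homogeneous_polynomial (2 + 2)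
        (\<lambda>X. a * (action1 X * action1 X) + b * (action1 X * action2 X) + c * (action2 X * action2 X))"
      by (intro homogeneous_polynomial_add homogeneous_polynomial_scale
          homogeneous_polynomial_mult homogeneous_actions)
    then show ?thesis by (simp add: N4_def[abs_def] power2_eq_square mult.assoc)
  qed
  have "poisson_bracket (quadratic_part \<omega>\<^sub>1 \<omega>\<^sub>2) (quadratic_part \<omega>\<^sub>1 \<omega>\<^sub>2) X = 0" for X
    by (simp add: poisson_bracket_def)
  moreover have "poisson_bracket N4 (quadratic_part \<omega>\<^sub>1 \<omega>\<^sub>2) X = 0" for X
    by (rule poisson_bracket_quadratic_part_eq_0[of _ "2 * a * action1 X + b * action2 X" _
          "b * action1 X + 2 * c * action2 X"], unfold N4_def[abs_def])
       (auto intro!: derivative_eq_intros action_derivatives simp: algebra_simps)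
  moreover have "poisson_bracket (\<lambda>_. 0) (quadratic_part \<omega>\<^sub>1 \<omega>\<^sub>2) X = 0" for X
    by (rule poisson_bracket_quadratic_part_eq_0[of _ 0 _ 0]) simp
  ultimately have "homogeneous_polynomial k (h k) \<and>
      (\<forall>X. poisson_bracket (h k) (quadratic_part \<omega>\<^sub>1 \<omega>\<^sub>2) X = 0)" for k
    using hom2 hom4 by (simp add: h_def homogeneous_polynomial_zero)
  moreover have "{1..4} = {1, 2, 3, 4 :: nat}" by auto
  then have "\<omega>\<^sub>1 * action1 X + \<omega>\<^sub>2 * action2 X + a * (action1 X)\<^sup>2 + b * action1 X * action2 X
      + c * (action2 X)\<^sup>2 = (\<Sum>k=1..4. h k X)" for X
    by (simp add: h_def N4_def quadratic_part_actions)
  moreover have "h 2 = quadratic_part \<omega>\<^sub>1 \<omega>\<^sub>2" by (simp add: h_def)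
  ultimately show ?thesis
    using assms unfolding birkhoff_normal_form_def
    by (intro conjI exI[of _ h]) (simp_all add: quadratic_part_actions add.assoc)
qed

section \<open>Diagonalisation\<close>

text \<open>The pairs are the columns of two diagonal blocks: \<open>(e1, f1)\<close> and
  \<open>(e2, f2)\<close> act on positions, \<open>(c1, d1)\<close> and \<open>(c2, d2)\<close> on
  momenta. Keeping positions and momenta apart preserves evenness in the momenta.\<close>

definition mode_map :: "real \<times> real \<Rightarrow> real \<times> real \<Rightarrow> real \<times> real \<Rightarrow> real \<times> real \<Rightarrow> real^4 \<Rightarrow> real^4" where
  "mode_map = (\<lambda>(e1, f1) (e2, f2) (c1, d1) (c2, d2) X.
     vector [e1 * X $ 1 + e2 * X $ 2, f1 * X $ 1 + f2 * X $ 2,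
             c1 * X $ 3 + c2 * X $ 4, d1 * X $ 3 + d2 * X $ 4])"

lemma mode_map_nth:
  "mode_map (e1, f1) (e2, f2) (c1, d1) (c2, d2) X $ 1 = e1 * X $ 1 + e2 * X $ 2"
  "mode_map (e1, f1) (e2, f2) (c1, d1) (c2, d2) X $ 2 = f1 * X $ 1 + f2 * X $ 2"
  "mode_map (e1, f1) (e2, f2) (c1, d1) (c2, d2) X $ 3 = c1 * X $ 3 + c2 * X $ 4"
  "mode_map (e1, f1) (e2, f2) (c1, d1) (c2, d2) X $ 4 = d1 * X $ 3 + d2 * X $ 4"
  by (simp_all add: mode_map_def vector_4)

lemma bounded_linear_mode_map: "bounded_linear (mode_map (e1, f1) (e2, f2) (c1, d1) (c2, d2))"
  unfolding linear_conv_bounded_linear[symmetric]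
  by (rule linearI) (simp_all add: vec_eq_iff forall_4 mode_map_nth algebra_simps)

text \<open>The four equations say that the momentum block is the inverse transpose of the position
  block.\<close>

lemma mode_map_canonical:
  assumes "e1 * c1 + f1 * d1 = 1" "e1 * c2 + f1 * d2 = 0" "e2 * c1 + f2 * d1 = 0" "e2 * c2 + f2 * d2 = 1"
  shows "polynomial_canonical (mode_map (e1, f1) (e2, f2) (c1, d1) (c2, d2))" (is "polynomial_canonical ?L")
  unfolding polynomial_canonical_def
proof (intro conjI allI)
  show "polynomial_function ?L"
    by (rule polynomial_function_bounded_linear[OF bounded_linear_mode_map])
  fix X
  have "symplectic_form (?L u) (?L v) = symplectic_form u v" for u v
  proof -
    have "symplectic_form (?L u) (?L v) =
        (e1 * c1 + f1 * d1) * (u $ 1 * v $ 3 - u $ 3 * v $ 1) + (e1 * c2 + f1 * d2) * (u $ 1 * v $ 4 - u $ 4 * v $ 1)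
      + (e2 * c1 + f2 * d1) * (u $ 2 * v $ 3 - u $ 3 * v $ 2) + (e2 * c2 + f2 * d2) * (u $ 2 * v $ 4 - u $ 4 * v $ 2)"
      by (simp add: symplectic_form_def mode_map_nth algebra_simps)
    then show ?thesis unfolding assms by (simp add: symplectic_form_def)
  qed
  then show "\<exists>D. (?L has_derivative D) (at X) \<and>
      (\<forall>u v. symplectic_form (D u) (D v) = symplectic_form u v)"
    using bounded_linear_imp_has_derivative[OF bounded_linear_mode_map] by blast
qed

lemma mode_map_norm: "(\<lambda>X. norm (mode_map (e1, f1) (e2, f2) (c1, d1) (c2, d2) X)) \<in> O_norm 1"
proof -
  obtain K where "\<And>X. norm (mode_map (e1, f1) (e2, f2) (c1, d1) (c2, d2) X) \<le> norm X * K"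
    using bounded_linear.bounded[OF bounded_linear_mode_map] by blast
  then show ?thesis by (intro bigoI[of _ K]) (simp add: mult.commute)
qed

lemma formlike_linear_combination: "formlike 1 (\<lambda>X. a * X $ i + b * X $ j)"
  by (intro formlike_add formlike_scale formlike_component)

lemma formlike_quartic_mode_map:
  "formlike 4 (\<lambda>X. hamiltonian_quartic \<alpha> \<beta> \<delta> (mode_map (e1, f1) (e2, f2) (c1, d1) (c2, d2) X))"
proof -
  note lin = formlike_linear_combination
  have 1: "formlike 4 (\<lambda>X. - (1 - \<beta>\<^sup>2) / (2 * \<alpha> * \<beta> ^ 4) *
      ((c1 * X $ 3 + c2 * X $ 4)\<^sup>2 * (e1 * X $ 1 + e2 * X $ 2)\<^sup>2))"
    using formlike_scale[OF formlike_mult[OF formlike_power[OF lin] formlike_power[OF lin]],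
      of 2 2 "- (1 - \<beta>\<^sup>2) / (2 * \<alpha> * \<beta> ^ 4)" c1 3 c2 4 e1 1 e2 2] by simp
  have 2: "formlike 4 (\<lambda>X. \<beta> / 6 * ((f1 * X $ 1 + f2 * X $ 2) * (e1 * X $ 1 + e2 * X $ 2) ^ 3))"
    using formlike_scale[OF formlike_mult[OF lin formlike_power[OF lin]],
      of 3 "\<beta> / 6" f1 1 f2 2 e1 1 e2 2] by simp
  have 3: "formlike 4 (\<lambda>X. (1 / 8 - \<beta>\<^sup>2 / 6 - \<delta> / 24) * (e1 * X $ 1 + e2 * X $ 2) ^ 4)"
    using formlike_scale[OF formlike_power[OF lin],
      of 4 "1 / 8 - \<beta>\<^sup>2 / 6 - \<delta> / 24" e1 1 e2 2] by simp
  show ?thesis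
    unfolding hamiltonian_quartic_def mode_map_nth by (rule formlike_add[OF formlike_add[OF 1 2] 3])
qed

text \<open>The formulas for \<open>a\<close>, \<open>b\<close>, \<open>c\<close> collect the torus
  averages of the monomials in the expanded quartic: 3/2 for a fourth power and 1/2 for a product of
  squares within one mode, 1 for a product of squares from different modes, and 0 for the monomials
  odd in a mode.\<close>

lemma removable_even_quartic:
  fixes k1 k2 k3 :: real
  assumes "\<omega>\<^sub>1 \<noteq> 0" "\<omega>\<^sub>2 \<noteq> 0" "\<omega>\<^sub>1\<^sup>2 \<noteq> \<omega>\<^sub>2\<^sup>2" "\<omega>\<^sub>1\<^sup>2 \<noteq> 9 * \<omega>\<^sub>2\<^sup>2" "\<omega>\<^sub>2\<^sup>2 \<noteq> 9 * \<omega>\<^sub>1\<^sup>2"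
    and a: "a = k1 * c1\<^sup>2 * e1\<^sup>2 / 2 + 3 / 2 * (k2 * f1 * e1 ^ 3 + k3 * e1 ^ 4)"
    and b: "b = k1 * (c1\<^sup>2 * e2\<^sup>2 + c2\<^sup>2 * e1\<^sup>2) + 3 * k2 * (f1 * e1 * e2\<^sup>2 + f2 * e1\<^sup>2 * e2) + 6 * k3 * e1\<^sup>2 * e2\<^sup>2"
    and c: "c = k1 * c2\<^sup>2 * e2\<^sup>2 / 2 + 3 / 2 * (k2 * f2 * e2 ^ 3 + k3 * e2 ^ 4)"
  shows "removable \<omega>\<^sub>1 \<omega>\<^sub>2 (\<lambda>X. a * (action1 X)\<^sup>2 + b * action1 X * action2 X + c * (action2 X)\<^sup>2
    - (k1 * ((c1 * X $ 3 + c2 * X $ 4)\<^sup>2 * (e1 * X $ 1 + e2 * X $ 2)\<^sup>2)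
     + k2 * ((f1 * X $ 1 + f2 * X $ 2) * (e1 * X $ 1 + e2 * X $ 2) ^ 3)
     + k3 * (e1 * X $ 1 + e2 * X $ 2) ^ 4))"
proof -
  note m1 = normalize_mode1[OF assms(1-5)] and m2 = normalize_mode2[OF assms(1-5)]
    and m12 = normalize_mixed[OF assms(1-5)]
    and c12 = normalize_cubic_linear12[OF assms(1-5)] and c21 = normalize_cubic_linear21[OF assms(1-5)]
  note sc = removable_scale and ad = removable.add
  show ?thesis
  \<comment> \<open>Each scalar is minus the coefficient of the corresponding monomial in the
    expansion of the quartic.\<close>
  proof (rule removable_cong, rule ad[OF ad[OF ad[OF ad[OF
        sc[OF m1(1), of "- (k2 * f1 * e1 ^ 3 + k3 * e1 ^ 4)"]
        sc[OF m1(2), of "- (k1 * c1\<^sup>2 * e1\<^sup>2)"]] ad[OF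
        sc[OF m2(1), of "- (k2 * f2 * e2 ^ 3 + k3 * e2 ^ 4)"]
        sc[OF m2(2), of "- (k1 * c2\<^sup>2 * e2\<^sup>2)"]]] ad[OF ad[OF
        sc[OF m12(1), of "- (4 * k1 * c1 * c2 * e1 * e2)"]
        sc[OF m12(2), of "- (3 * k2 * (f1 * e1 * e2\<^sup>2 + f2 * e1\<^sup>2 * e2) + 6 * k3 * e1\<^sup>2 * e2\<^sup>2)"]] ad[OF
        sc[OF m12(3), of "- (k1 * c2\<^sup>2 * e1\<^sup>2)"]
        sc[OF m12(4), of "- (k1 * c1\<^sup>2 * e2\<^sup>2)"]]]] ad[OF ad[OF ad[OF
        sc[OF c12(1), of "- (k2 * (3 * f1 * e1\<^sup>2 * e2 + f2 * e1 ^ 3) + 4 * k3 * e1 ^ 3 * e2)"]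
        sc[OF c12(2), of "- (2 * k1 * c1 * c2 * e1\<^sup>2)"]]
        sc[OF c12(3), of "- (2 * k1 * c1\<^sup>2 * e1 * e2)"]] ad[OF ad[OF
        sc[OF c21(1), of "- (k2 * (f1 * e2 ^ 3 + 3 * f2 * e1 * e2\<^sup>2) + 4 * k3 * e1 * e2 ^ 3)"]
        sc[OF c21(2), of "- (2 * k1 * c1 * c2 * e2\<^sup>2)"]]
        sc[OF c21(3), of "- (2 * k1 * c2\<^sup>2 * e1 * e2)"]]]])
  qed (simp add: a b c field_simps power2_eq_square power3_eq_cube power4_eq_xxxx)
qed

text \<open>The squared frequencies are the roots of \<open>G * z\<^sup>2 - S * z + \<delta>\<close>
  with \<open>G = \<alpha> * \<beta>\<^sup>2\<close> and
  \<open>S = (\<alpha> + 1) * \<beta>\<^sup>2 + \<delta>\<close>. Vieta gives their product, and the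
  value of this polynomial at 1 is \<open>- \<beta>\<^sup>2\<close>, which gives the other relation.
  That value being negative, 1 lies strictly between the roots.\<close>

lemma frequency_relations:
  fixes \<alpha> \<beta> \<delta> \<omega>\<^sub>1 \<omega>\<^sub>2 :: real
  assumes pos: "\<alpha> > 0" "\<beta> > 0" "\<delta> > 0"
    and \<omega>1: "\<omega>\<^sub>1 = sqrt 2 * sqrt ((\<alpha> + 1) * \<beta>\<^sup>2 + \<delta> +
            sqrt ((\<alpha> + 1)\<^sup>2 * \<beta>^4 - 2 * (\<alpha> - 1) * \<beta>\<^sup>2 * \<delta> + \<delta>\<^sup>2)) / (2 * \<beta> * sqrt \<alpha>)"
    and \<omega>2: "\<omega>\<^sub>2 = sqrt 2 * sqrt ((\<alpha> + 1) * \<beta>\<^sup>2 + \<delta> -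
            sqrt ((\<alpha> + 1)\<^sup>2 * \<beta>^4 - 2 * (\<alpha> - 1) * \<beta>\<^sup>2 * \<delta> + \<delta>\<^sup>2)) / (2 * \<beta> * sqrt \<alpha>)"
  shows "\<omega>\<^sub>1 > 0" "\<omega>\<^sub>2 > 0" "\<omega>\<^sub>1\<^sup>2 > 1" "\<omega>\<^sub>2\<^sup>2 < 1"
    and "\<alpha> * ((\<omega>\<^sub>1\<^sup>2 - 1) * (\<omega>\<^sub>2\<^sup>2 - 1)) = - 1" and "\<alpha> * \<beta>\<^sup>2 * (\<omega>\<^sub>1\<^sup>2 * \<omega>\<^sub>2\<^sup>2) = \<delta>"
proof -
  define S where "S = (\<alpha> + 1) * \<beta>\<^sup>2 + \<delta>"
  define D where "D = (\<alpha> + 1)\<^sup>2 * \<beta>^4 - 2 * (\<alpha> - 1) * \<beta>\<^sup>2 * \<delta> + \<delta>\<^sup>2"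
  define r where "r = sqrt D"
  define G where "G = \<alpha> * \<beta>\<^sup>2"
  \<comment> \<open>Completing the square makes the discriminant visibly positive, so both roots are
    real and distinct.\<close>
  have "D = (\<delta> - (\<alpha> - 1) * \<beta>\<^sup>2)\<^sup>2 + 4 * \<alpha> * \<beta> ^ 4"
    unfolding D_def by algebra
  then have D: "D > 0" using pos by (simp add: add_nonneg_pos)
  have S: "S > 0" unfolding S_def using pos by (simp add: add_pos_pos)
  have G: "G > 0" unfolding G_def using pos by simp
  have SD: "S\<^sup>2 - D = 4 * G * \<delta>" unfolding S_def D_def G_def by algebra
  have r: "r > 0" "r\<^sup>2 = D" unfolding r_def using D by simp_all
  have "r\<^sup>2 < S\<^sup>2" using SD mult_pos_pos[OF G pos(3)] r by simp
  then have rS: "r < S" using S by (simp add: power2_less_imp_less)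
  have w: "\<omega>\<^sub>1 = sqrt 2 * sqrt (S + r) / (2 * \<beta> * sqrt \<alpha>)" "\<omega>\<^sub>2 = sqrt 2 * sqrt (S - r) / (2 * \<beta> * sqrt \<alpha>)"
    unfolding \<omega>1 \<omega>2 S_def r_def D_def by simp_all
  show p: "\<omega>\<^sub>1 > 0" "\<omega>\<^sub>2 > 0" unfolding w using pos r rS S by simp_all
  have w1: "2 * G * \<omega>\<^sub>1\<^sup>2 = S + r" unfolding w G_def using pos r S
    by (simp add: power_divide power_mult_distrib field_simps)
  have w2: "2 * G * \<omega>\<^sub>2\<^sup>2 = S - r" unfolding w G_def using pos rS
    by (simp add: power_divide power_mult_distrib field_simps)
  have "4 * G * (G * (\<omega>\<^sub>1\<^sup>2 * \<omega>\<^sub>2\<^sup>2)) = (2 * G * \<omega>\<^sub>1\<^sup>2) * (2 * G * \<omega>\<^sub>2\<^sup>2)" by (simp add: mult_ac)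
  also have "\<dots> = S\<^sup>2 - r\<^sup>2" unfolding w1 w2 by (simp add: power2_eq_square algebra_simps)
  also have "\<dots> = 4 * G * \<delta>" using SD r by simp
  finally have prod: "G * (\<omega>\<^sub>1\<^sup>2 * \<omega>\<^sub>2\<^sup>2) = \<delta>" using G by simp
  then show "\<alpha> * \<beta>\<^sup>2 * (\<omega>\<^sub>1\<^sup>2 * \<omega>\<^sub>2\<^sup>2) = \<delta>" unfolding G_def .
  have "G * (\<omega>\<^sub>1\<^sup>2 + \<omega>\<^sub>2\<^sup>2) = S" using w1 w2 by (simp add: distrib_left)
  then have "G * ((\<omega>\<^sub>1\<^sup>2 - 1) * (\<omega>\<^sub>2\<^sup>2 - 1)) = \<delta> - S + G" using prod by (simp add: algebra_simps)
  also have "\<dots> = - \<beta>\<^sup>2" unfolding S_def G_def by (simp add: algebra_simps)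
  finally have "\<beta>\<^sup>2 * (\<alpha> * ((\<omega>\<^sub>1\<^sup>2 - 1) * (\<omega>\<^sub>2\<^sup>2 - 1))) = \<beta>\<^sup>2 * (- 1)" unfolding G_def by (simp add: mult_ac)
  then show a: "\<alpha> * ((\<omega>\<^sub>1\<^sup>2 - 1) * (\<omega>\<^sub>2\<^sup>2 - 1)) = - 1" using pos by (simp only: mult_cancel_left) simp
  then have neg: "(\<omega>\<^sub>1\<^sup>2 - 1) * (\<omega>\<^sub>2\<^sup>2 - 1) < 0" using pos by (metis mult_less_0_iff less_asym neg_less_0_iff_less zero_less_one)
  have "2 * G * \<omega>\<^sub>2\<^sup>2 < 2 * G * \<omega>\<^sub>1\<^sup>2" using w1 w2 r by simp
  then have "\<omega>\<^sub>2\<^sup>2 < \<omega>\<^sub>1\<^sup>2" using G by simp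
  with neg show "\<omega>\<^sub>1\<^sup>2 > 1" "\<omega>\<^sub>2\<^sup>2 < 1" by (auto simp: mult_less_0_iff)
qed

text \<open>Here \<open>u\<close> and \<open>v\<close> stand for \<open>\<omega>\<^sub>1\<^sup>2 - 1\<close> and \<open>\<omega>\<^sub>2\<^sup>2 - 1\<close>, in terms of which
  \<open>\<alpha>\<close> and \<open>\<beta>\<^sup>2\<close> are rational.\<close>

lemma diagonal_coefficient_identity:
  fixes x y u v \<alpha> b \<delta> :: real
  assumes "x = u + 1" "y = v + 1" "x \<noteq> 0" "y \<noteq> 0" "u \<noteq> 0" "v \<noteq> 0"
    and "\<alpha> = - 1 / (u * v)" "b = - \<delta> * u * v / (x * y)"
  shows "- (1 - b) * \<alpha> * x / 4 + 3 / 2 * (- b / (6 * u) + (1 / 8 - b / 6 - \<delta> / 24)) =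
    (4 * x + 3 * (1 + \<delta>) * (u * v)) / (16 * (u * v))"
proof -
  have f: "b / u = - \<delta> * v / (x * y)" "\<alpha> * b = \<delta> / (x * y)"
    unfolding assms(7,8) using assms(3-6) by simp_all
  have "- (1 - b) * \<alpha> * x / 4 + 3 / 2 * (- b / (6 * u) + (1 / 8 - b / 6 - \<delta> / 24)) =
      - \<alpha> * x / 4 + (\<alpha> * b) * x / 4 - b / u / 4 - b / 4 + 3 / 16 - \<delta> / 16"
    by (simp add: field_simps)
  also have "\<dots> =
      x / (4 * (u * v)) + \<delta> * (x + v + u * v) / (4 * (x * y)) + 3 / 16 - \<delta> / 16"
    unfolding f unfolding assms(7,8) by (simp add: add_divide_distrib distrib_left mult_ac)
  \<comment> \<open>The contributions containing \<delta> gather into a multiple of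
    \<open>x * y\<close>, so this product disappears from the denominator.\<close>
  also have "x + v + u * v = x * y" using assms(1,2) by (simp add: algebra_simps)
  also have "\<delta> * (x * y) / (4 * (x * y)) = \<delta> / 4" using assms(3,4) by simp
  finally show ?thesis using assms(5,6) by (simp add: field_simps)
qed

text \<open>This evaluates the factor that multiplies \<open>e1\<^sup>2 * e2\<^sup>2\<close> in the
  coefficient of the product of the two actions. As in the diagonal case, the terms with \<delta>
  sum to a multiple of \<open>x * y\<close>.\<close>

lemma mixed_coefficient_identity:
  fixes x y u v \<alpha> b \<delta> :: real
  assumes "x = u + 1" "y = v + 1" "x \<noteq> 0" "y \<noteq> 0" "u \<noteq> 0" "v \<noteq> 0"
    and "\<alpha> = - 1 / (u * v)" "b = - \<delta> * u * v / (x * y)"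
  shows "- (1 - b) * \<alpha> * (x + y) / 2 - b / 2 * (1 / u + 1 / v) + 6 * (1 / 8 - b / 6 - \<delta> / 24) =
    (2 * (x + y) + 3 * (1 + \<delta>) * (u * v)) / (4 * (u * v))"
proof -
  have f: "b * (1 / u) = - \<delta> * v / (x * y)" "b * (1 / v) = - \<delta> * u / (x * y)" "\<alpha> * b = \<delta> / (x * y)"
    unfolding assms(7,8) using assms(3-6) by simp_all
  have "- (1 - b) * \<alpha> * (x + y) / 2 - b / 2 * (1 / u + 1 / v) + 6 * (1 / 8 - b / 6 - \<delta> / 24) =
      - \<alpha> * (x + y) / 2 + (\<alpha> * b) * (x + y) / 2 - b * (1 / u) / 2 - b * (1 / v) / 2 - b + 3 / 4 - \<delta> / 4"
    by (simp add: field_simps)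
  also have "\<dots> =
      (x + y) / (2 * (u * v)) + \<delta> * (x + y + u + v + 2 * (u * v)) / (2 * (x * y)) + 3 / 4 - \<delta> / 4"
    unfolding f unfolding assms(7,8) by (simp add: add_divide_distrib distrib_left mult_ac)
  also have "x + y + u + v + 2 * (u * v) = 2 * (x * y)" using assms(1,2) by (simp add: algebra_simps)
  also have "\<delta> * (2 * (x * y)) / (2 * (x * y)) = \<delta>" using assms(3,4) by simp
  finally show ?thesis using assms(5,6) by (simp add: field_simps)
qed

theorem mainTheorem2:
  fixes \<alpha> \<beta> \<delta> \<omega>\<^sub>1 \<omega>\<^sub>2 h20 h11 h02 :: real
  assumes "\<alpha> > 0" and "\<beta> > 0" and "\<delta> > 0"
    and "\<omega>\<^sub>1 = sqrt 2 * sqrt ((\<alpha> + 1) * \<beta>\<^sup>2 + \<delta> +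
            sqrt ((\<alpha> + 1)\<^sup>2 * \<beta>^4 - 2 * (\<alpha> - 1) * \<beta>\<^sup>2 * \<delta> + \<delta>\<^sup>2)) / (2 * \<beta> * sqrt \<alpha>)"
    and "\<omega>\<^sub>2 = sqrt 2 * sqrt ((\<alpha> + 1) * \<beta>\<^sup>2 + \<delta> -
            sqrt ((\<alpha> + 1)\<^sup>2 * \<beta>^4 - 2 * (\<alpha> - 1) * \<beta>\<^sup>2 * \<delta> + \<delta>\<^sup>2)) / (2 * \<beta> * sqrt \<alpha>)"
    and "\<And>m n :: int. 0 < \<bar>m\<bar> + \<bar>n\<bar> \<Longrightarrow> \<bar>m\<bar> + \<bar>n\<bar> \<le> 4 \<Longrightarrow>
            of_int m * \<omega>\<^sub>1 + of_int n * \<omega>\<^sub>2 \<noteq> 0"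
    and "h20 = \<omega>\<^sub>1\<^sup>2 * \<omega>\<^sub>2^4 * (\<omega>\<^sub>1\<^sup>2 - 1) *
            (3 * \<delta> * (\<omega>\<^sub>1\<^sup>2 - 1) * (\<omega>\<^sub>2\<^sup>2 - 1) + (3 * \<omega>\<^sub>2\<^sup>2 + 1) * \<omega>\<^sub>1\<^sup>2 - 3 * \<omega>\<^sub>2\<^sup>2 + 3) /
            (16 * \<delta>\<^sup>2 * (\<omega>\<^sub>1\<^sup>2 - \<omega>\<^sub>2\<^sup>2)\<^sup>2 * (\<omega>\<^sub>2\<^sup>2 - 1))"
    and "h11 = \<omega>\<^sub>1^3 * \<omega>\<^sub>2^3 *
            ((1 - 3 * \<omega>\<^sub>2\<^sup>2) * \<omega>\<^sub>1\<^sup>2 + \<omega>\<^sub>2\<^sup>2 - 3 - 3 * \<delta> * (\<omega>\<^sub>1\<^sup>2 - 1) * (\<omega>\<^sub>2\<^sup>2 - 1)) /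
            (4 * \<delta>\<^sup>2 * (\<omega>\<^sub>1\<^sup>2 - \<omega>\<^sub>2\<^sup>2)\<^sup>2)"
    and "h02 = \<omega>\<^sub>1^4 * \<omega>\<^sub>2\<^sup>2 * (\<omega>\<^sub>2\<^sup>2 - 1) *
            (3 * \<delta> * (\<omega>\<^sub>1\<^sup>2 - 1) * (\<omega>\<^sub>2\<^sup>2 - 1) + 3 * (\<omega>\<^sub>2\<^sup>2 - 1) * \<omega>\<^sub>1\<^sup>2 + \<omega>\<^sub>2\<^sup>2 + 3) /
            (16 * \<delta>\<^sup>2 * (\<omega>\<^sub>1\<^sup>2 - 1) * (\<omega>\<^sub>1\<^sup>2 - \<omega>\<^sub>2\<^sup>2)\<^sup>2)"
  shows "birkhoff_normal_form 4 \<omega>\<^sub>1 \<omega>\<^sub>2 (hamiltonian \<alpha> \<beta> \<delta>)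
           (\<lambda>X. \<omega>\<^sub>1 * action1 X + \<omega>\<^sub>2 * action2 X +
                h20 * (action1 X)\<^sup>2 + h11 * action1 X * action2 X + h02 * (action2 X)\<^sup>2)"
proof -
  note freq = frequency_relations[OF assms(1-5)]
  define u v where "u = \<omega>\<^sub>1\<^sup>2 - 1" and "v = \<omega>\<^sub>2\<^sup>2 - 1"
  have uv: "u > 0" "v < 0" using freq(3,4) by (simp_all add: u_def v_def)
  have xy: "\<omega>\<^sub>1\<^sup>2 = u + 1" "\<omega>\<^sub>2\<^sup>2 = v + 1" by (simp_all add: u_def v_def)
  have \<alpha>: "\<alpha> = - 1 / (u * v)"
    using freq(5) uv unfolding u_def[symmetric] v_def[symmetric] by (simp add: field_simps)
  have "\<beta>\<^sup>2 = \<delta> / (\<alpha> * (\<omega>\<^sub>1\<^sup>2 * \<omega>\<^sub>2\<^sup>2))"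
    using freq(1,2,6) assms(1) by (simp add: field_simps)
  then have \<beta>: "\<beta>\<^sup>2 = - \<delta> * u * v / (\<omega>\<^sub>1\<^sup>2 * \<omega>\<^sub>2\<^sup>2)"
    using uv by (simp add: \<alpha> field_simps)
  have nz: "\<omega>\<^sub>1 \<noteq> 0" "\<omega>\<^sub>2 \<noteq> 0" "u \<noteq> 0" "v \<noteq> 0" "u - v \<noteq> 0" "\<delta> \<noteq> 0" "\<alpha> \<noteq> 0" "\<beta> \<noteq> 0"
    using freq(1,2) uv assms(1-3) by auto

  \<comment> \<open>\<open>(e1, f1)\<close> and \<open>(e2, f2)\<close> are the eigenvectors of the linearised system, scaled so that
    the linear change of variables is symplectic.\<close>
  define E1 E2 where "E1 = u * \<omega>\<^sub>1 * \<omega>\<^sub>2\<^sup>2 / (\<delta> * (u - v))" and "E2 = - v * \<omega>\<^sub>1\<^sup>2 * \<omega>\<^sub>2 / (\<delta> * (u - v))"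
  define e1 e2 where "e1 = sqrt E1" and "e2 = sqrt E2"
  have "E1 \<ge> 0" "E2 \<ge> 0"
    unfolding E1_def E2_def
    by (intro divide_nonneg_pos mult_nonneg_nonneg mult_pos_pos; use freq(1,2) uv assms(3) in simp)+
  then have e: "e1\<^sup>2 = E1" "e2\<^sup>2 = E2" unfolding e1_def e2_def by simp_all
  \<comment> \<open>The second row of the eigenvalue equation reads
    \<open>(1 - \<omega>\<^sup>2) * f = \<beta> * e\<close>. Momenta are frequency times mass times
    position, with masses \<open>\<alpha> * \<beta>\<^sup>2\<close> and 1.\<close>
  define f1 f2 where "f1 = - \<beta> / u * e1" and "f2 = - \<beta> / v * e2"
  define c1 c2 where "c1 = \<alpha> * \<beta>\<^sup>2 * \<omega>\<^sub>1 * e1" and "c2 = \<alpha> * \<beta>\<^sup>2 * \<omega>\<^sub>2 * e2"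
  define d1 d2 where "d1 = \<omega>\<^sub>1 * f1" and "d2 = \<omega>\<^sub>2 * f2"
  let ?L = "mode_map (e1, f1) (e2, f2) (c1, d1) (c2, d2)"

  \<comment> \<open>The identities \<open>n1\<close>, \<open>n2\<close>, \<open>n12\<close> express
    orthogonality of the eigenvectors for the mass form, with squared lengths the inverse
    frequencies. Below, \<open>p1\<close>, \<open>p2\<close>, \<open>p12\<close> do the same for the
    stiffness form, with squared lengths the frequencies. The first group yields symplecticity and
    the kinetic energy, the second the potential energy.\<close>
  have n1: "\<alpha> * \<beta>\<^sup>2 * e1\<^sup>2 + f1\<^sup>2 = 1 / \<omega>\<^sub>1"
  proof -
    have "\<alpha> * \<beta>\<^sup>2 * e1\<^sup>2 + f1\<^sup>2 = E1 * (\<beta>\<^sup>2 * (\<alpha> + 1 / u\<^sup>2))"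
      by (simp add: f1_def e power_mult_distrib power_divide algebra_simps)
    also have "\<alpha> + 1 / u\<^sup>2 = - (u - v) / (u\<^sup>2 * v)"
      unfolding \<alpha> using nz by (simp add: field_simps power2_eq_square)
    also have "E1 * (\<beta>\<^sup>2 * (- (u - v) / (u\<^sup>2 * v))) = 1 / \<omega>\<^sub>1"
      unfolding \<beta> E1_def using nz by (simp add: divide_simps) (simp add: power2_eq_square algebra_simps)
    finally show ?thesis .
  qed
  have n2: "\<alpha> * \<beta>\<^sup>2 * e2\<^sup>2 + f2\<^sup>2 = 1 / \<omega>\<^sub>2"
  proof -
    have "\<alpha> * \<beta>\<^sup>2 * e2\<^sup>2 + f2\<^sup>2 = E2 * (\<beta>\<^sup>2 * (\<alpha> + 1 / v\<^sup>2))"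
      by (simp add: f2_def e power_mult_distrib power_divide algebra_simps)
    also have "\<alpha> + 1 / v\<^sup>2 = (u - v) / (u * v\<^sup>2)"
      unfolding \<alpha> using nz by (simp add: field_simps power2_eq_square)
    also have "E2 * (\<beta>\<^sup>2 * ((u - v) / (u * v\<^sup>2))) = 1 / \<omega>\<^sub>2"
      unfolding \<beta> E2_def using nz by (simp add: divide_simps) (simp add: power2_eq_square algebra_simps)
    finally show ?thesis .
  qed
  have n12: "\<alpha> * \<beta>\<^sup>2 * e1 * e2 + f1 * f2 = 0"
    using nz by (simp add: f1_def f2_def \<alpha> power2_eq_square field_simps)
  have g1: "f1 - \<beta> * e1 = - \<beta> * e1 * \<omega>\<^sub>1\<^sup>2 / u" and g2: "f2 - \<beta> * e2 = - \<beta> * e2 * \<omega>\<^sub>2\<^sup>2 / v"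
    using nz by (simp_all add: f1_def f2_def xy field_simps)
  have p1: "(f1 - \<beta> * e1)\<^sup>2 + \<delta> * e1\<^sup>2 = \<omega>\<^sub>1"
  proof -
    have "(f1 - \<beta> * e1)\<^sup>2 + \<delta> * e1\<^sup>2 = E1 * (\<beta>\<^sup>2 * (\<omega>\<^sub>1\<^sup>2)\<^sup>2 / u\<^sup>2 + \<delta>)"
      unfolding g1 by (simp add: e power_mult_distrib power_divide algebra_simps)
    also have "\<beta>\<^sup>2 * (\<omega>\<^sub>1\<^sup>2)\<^sup>2 / u\<^sup>2 + \<delta> = \<delta> * (u * \<omega>\<^sub>2\<^sup>2 - v * \<omega>\<^sub>1\<^sup>2) / (u * \<omega>\<^sub>2\<^sup>2)"
      unfolding \<beta> using nz by (simp add: divide_simps) (simp add: power2_eq_square power4_eq_xxxx algebra_simps)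
    also have "u * \<omega>\<^sub>2\<^sup>2 - v * \<omega>\<^sub>1\<^sup>2 = u - v" by (simp add: xy algebra_simps)
    also have "E1 * (\<delta> * (u - v) / (u * \<omega>\<^sub>2\<^sup>2)) = \<omega>\<^sub>1"
      unfolding E1_def using nz by simp
    finally show ?thesis .
  qed
  have p2: "(f2 - \<beta> * e2)\<^sup>2 + \<delta> * e2\<^sup>2 = \<omega>\<^sub>2"
  proof -
    have "(f2 - \<beta> * e2)\<^sup>2 + \<delta> * e2\<^sup>2 = E2 * (\<beta>\<^sup>2 * (\<omega>\<^sub>2\<^sup>2)\<^sup>2 / v\<^sup>2 + \<delta>)"
      unfolding g2 by (simp add: e power_mult_distrib power_divide algebra_simps)
    also have "\<beta>\<^sup>2 * (\<omega>\<^sub>2\<^sup>2)\<^sup>2 / v\<^sup>2 + \<delta> = \<delta> * (v * \<omega>\<^sub>1\<^sup>2 - u * \<omega>\<^sub>2\<^sup>2) / (v * \<omega>\<^sub>1\<^sup>2)"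
      unfolding \<beta> using nz by (simp add: divide_simps) (simp add: power2_eq_square power4_eq_xxxx algebra_simps)
    also have "v * \<omega>\<^sub>1\<^sup>2 - u * \<omega>\<^sub>2\<^sup>2 = - (u - v)" by (simp add: xy algebra_simps)
    also have "E2 * (\<delta> * - (u - v) / (v * \<omega>\<^sub>1\<^sup>2)) = \<omega>\<^sub>2"
      unfolding E2_def using nz by (simp add: divide_simps) (simp add: algebra_simps)
    finally show ?thesis .
  qed
  have p12: "(f1 - \<beta> * e1) * (f2 - \<beta> * e2) + \<delta> * e1 * e2 = 0"
  proof -
    have "(f1 - \<beta> * e1) * (f2 - \<beta> * e2) + \<delta> * e1 * e2 =
        e1 * e2 * (\<beta>\<^sup>2 * (\<omega>\<^sub>1\<^sup>2 * \<omega>\<^sub>2\<^sup>2) / (u * v) + \<delta>)"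
      unfolding g1 g2 by (simp add: power2_eq_square algebra_simps)
    also have "\<beta>\<^sup>2 * (\<omega>\<^sub>1\<^sup>2 * \<omega>\<^sub>2\<^sup>2) / (u * v) + \<delta> = 0"
      unfolding \<beta> using nz by simp
    finally show ?thesis by simp
  qed

  have L: "polynomial_canonical ?L"
  proof (rule mode_map_canonical)
    have "e1 * c1 + f1 * d1 = \<omega>\<^sub>1 * (\<alpha> * \<beta>\<^sup>2 * e1\<^sup>2 + f1\<^sup>2)"
      by (simp add: c1_def d1_def power2_eq_square algebra_simps)
    then show "e1 * c1 + f1 * d1 = 1" unfolding n1 using nz by simp
    have "e2 * c2 + f2 * d2 = \<omega>\<^sub>2 * (\<alpha> * \<beta>\<^sup>2 * e2\<^sup>2 + f2\<^sup>2)"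
      by (simp add: c2_def d2_def power2_eq_square algebra_simps)
    then show "e2 * c2 + f2 * d2 = 1" unfolding n2 using nz by simp
    have "e1 * c2 + f1 * d2 = \<omega>\<^sub>2 * (\<alpha> * \<beta>\<^sup>2 * e1 * e2 + f1 * f2)"
      by (simp add: c2_def d2_def power2_eq_square algebra_simps)
    then show "e1 * c2 + f1 * d2 = 0" unfolding n12 by simp
    have "e2 * c1 + f2 * d1 = \<omega>\<^sub>1 * (\<alpha> * \<beta>\<^sup>2 * e1 * e2 + f1 * f2)"
      by (simp add: c1_def d1_def power2_eq_square algebra_simps)
    then show "e2 * c1 + f2 * d1 = 0" unfolding n12 by simp
  qed

  have K2: "hamiltonian_quadratic \<alpha> \<beta> \<delta> (?L X) = quadratic_part \<omega>\<^sub>1 \<omega>\<^sub>2 X" for X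
  proof -
    have "(c1 * P + c2 * p)\<^sup>2 / (\<alpha> * \<beta>\<^sup>2) + (d1 * P + d2 * p)\<^sup>2 =
        \<omega>\<^sub>1\<^sup>2 * (\<alpha> * \<beta>\<^sup>2 * e1\<^sup>2 + f1\<^sup>2) * P\<^sup>2 + \<omega>\<^sub>2\<^sup>2 * (\<alpha> * \<beta>\<^sup>2 * e2\<^sup>2 + f2\<^sup>2) * p\<^sup>2
        + 2 * \<omega>\<^sub>1 * \<omega>\<^sub>2 * (\<alpha> * \<beta>\<^sup>2 * e1 * e2 + f1 * f2) * P * p" for P p
    proof -
      have "c1 * P + c2 * p = (\<alpha> * \<beta>\<^sup>2) * (\<omega>\<^sub>1 * e1 * P + \<omega>\<^sub>2 * e2 * p)"
        by (simp add: c1_def c2_def algebra_simps)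
      then have "(c1 * P + c2 * p)\<^sup>2 / (\<alpha> * \<beta>\<^sup>2) = (\<alpha> * \<beta>\<^sup>2) * (\<omega>\<^sub>1 * e1 * P + \<omega>\<^sub>2 * e2 * p)\<^sup>2"
        using nz by (simp add: power2_eq_square)
      then show ?thesis unfolding d1_def d2_def by (simp add: power2_eq_square algebra_simps)
    qed
    also have "\<dots> P p = \<omega>\<^sub>1 * P\<^sup>2 + \<omega>\<^sub>2 * p\<^sup>2" for P p
      unfolding n1 n2 n12 using nz by (simp add: power2_eq_square)
    finally have kinetic: "(c1 * P + c2 * p)\<^sup>2 / (\<alpha> * \<beta>\<^sup>2) + (d1 * P + d2 * p)\<^sup>2 = \<omega>\<^sub>1 * P\<^sup>2 + \<omega>\<^sub>2 * p\<^sup>2" for P p .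
    have "((f1 * Q + f2 * q) - \<beta> * (e1 * Q + e2 * q))\<^sup>2 + \<delta> * (e1 * Q + e2 * q)\<^sup>2 =
        ((f1 - \<beta> * e1)\<^sup>2 + \<delta> * e1\<^sup>2) * Q\<^sup>2 + ((f2 - \<beta> * e2)\<^sup>2 + \<delta> * e2\<^sup>2) * q\<^sup>2
        + 2 * ((f1 - \<beta> * e1) * (f2 - \<beta> * e2) + \<delta> * e1 * e2) * Q * q" for Q q
      by algebra
    then have potential: "((f1 * Q + f2 * q) - \<beta> * (e1 * Q + e2 * q))\<^sup>2 + \<delta> * (e1 * Q + e2 * q)\<^sup>2 =
        \<omega>\<^sub>1 * Q\<^sup>2 + \<omega>\<^sub>2 * q\<^sup>2" for Q q
      unfolding p1 p2 p12 by simp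
    have halves: "(A + B + C + E) / 2 = w * (a + b) / 2 + w' * (c + d) / 2"
      if "A + B = w * b + w' * d" "C + E = w * a + w' * c" for A B C E w w' a b c d :: real
      using that by (simp add: field_simps)
    show ?thesis
      unfolding hamiltonian_quadratic_def mode_map_nth quadratic_part_def
      by (rule halves[OF kinetic potential])
  qed

  have nonres: "\<omega>\<^sub>1\<^sup>2 \<noteq> \<omega>\<^sub>2\<^sup>2" "\<omega>\<^sub>1\<^sup>2 \<noteq> 9 * \<omega>\<^sub>2\<^sup>2" "\<omega>\<^sub>2\<^sup>2 \<noteq> 9 * \<omega>\<^sub>1\<^sup>2"
  proof -
    \<comment> \<open>These are the order-four relations (1, -3) and (3, -1). Positivity handles the
      conjugate factors with a plus sign.\<close>
    have "\<omega>\<^sub>1 \<noteq> 3 * \<omega>\<^sub>2" "\<omega>\<^sub>2 \<noteq> 3 * \<omega>\<^sub>1"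
      using assms(6)[of 1 "-3"] assms(6)[of 3 "-1"] by auto
    then have "(\<omega>\<^sub>1 - 3 * \<omega>\<^sub>2) * (\<omega>\<^sub>1 + 3 * \<omega>\<^sub>2) \<noteq> 0" "(\<omega>\<^sub>2 - 3 * \<omega>\<^sub>1) * (\<omega>\<^sub>2 + 3 * \<omega>\<^sub>1) \<noteq> 0"
      using freq(1,2) by auto
    then show "\<omega>\<^sub>1\<^sup>2 \<noteq> 9 * \<omega>\<^sub>2\<^sup>2" "\<omega>\<^sub>2\<^sup>2 \<noteq> 9 * \<omega>\<^sub>1\<^sup>2"
      by (auto simp: power2_eq_square algebra_simps)
    show "\<omega>\<^sub>1\<^sup>2 \<noteq> \<omega>\<^sub>2\<^sup>2" using xy nz(5) by simp
  qed

  define k1 k2 k3 where "k1 = - (1 - \<beta>\<^sup>2) / (2 * \<alpha> * \<beta> ^ 4)" and "k2 = \<beta> / 6"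
    and "k3 = 1 / 8 - \<beta>\<^sup>2 / 6 - \<delta> / 24"
  \<comment> \<open>Since \<open>c1\<close> and \<open>f1\<close> are multiples of
    \<open>e1\<close>, and \<open>c2\<close> and \<open>f2\<close> of \<open>e2\<close>, the quartic
    coefficients involve only even powers of \<open>e1\<close> and \<open>e2\<close>, so the square
    roots drop out.\<close>
  have c: "k1 * c1\<^sup>2 = - (1 - \<beta>\<^sup>2) * \<alpha> / 2 * \<omega>\<^sub>1\<^sup>2 * e1\<^sup>2" "k1 * c2\<^sup>2 = - (1 - \<beta>\<^sup>2) * \<alpha> / 2 * \<omega>\<^sub>2\<^sup>2 * e2\<^sup>2"
    using nz by (simp_all add: k1_def c1_def c2_def divide_simps power2_eq_square power4_eq_xxxx)
  have kf: "k2 * f1 = - \<beta>\<^sup>2 / (6 * u) * e1" "k2 * f2 = - \<beta>\<^sup>2 / (6 * v) * e2"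
    by (simp_all add: k2_def f1_def f2_def power2_eq_square)
  have pw: "e1 ^ 4 = E1\<^sup>2" "e2 ^ 4 = E2\<^sup>2" by (simp_all add: e[symmetric] flip: power_mult)
  have h20: "h20 = k1 * c1\<^sup>2 * e1\<^sup>2 / 2 + 3 / 2 * (k2 * f1 * e1 ^ 3 + k3 * e1 ^ 4)"
  proof -
    have "k1 * c1\<^sup>2 * e1\<^sup>2 / 2 + 3 / 2 * (k2 * f1 * e1 ^ 3 + k3 * e1 ^ 4) =
        e1 ^ 4 * (- (1 - \<beta>\<^sup>2) * \<alpha> * \<omega>\<^sub>1\<^sup>2 / 4 + 3 / 2 * (- \<beta>\<^sup>2 / (6 * u) + k3))"
      unfolding c kf by (simp add: algebra_simps power2_eq_square power3_eq_cube power4_eq_xxxx)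
    also have "\<dots> = E1\<^sup>2 * ((4 * \<omega>\<^sub>1\<^sup>2 + 3 * (1 + \<delta>) * (u * v)) / (16 * (u * v)))"
      unfolding k3_def pw using diagonal_coefficient_identity[OF xy _ _ nz(3,4) \<alpha> \<beta>] nz by simp
    \<comment> \<open>Expanding only the part \<open>3 * (u * v)\<close> without \<delta> in terms
      of the frequencies produces the stated numerator.\<close>
    also have "4 * \<omega>\<^sub>1\<^sup>2 + 3 * (1 + \<delta>) * (u * v) =
        3 * \<delta> * u * v + (3 * \<omega>\<^sub>2\<^sup>2 + 1) * \<omega>\<^sub>1\<^sup>2 - 3 * \<omega>\<^sub>2\<^sup>2 + 3"
      by (simp add: u_def v_def algebra_simps)
    also have "E1\<^sup>2 * ((3 * \<delta> * u * v + (3 * \<omega>\<^sub>2\<^sup>2 + 1) * \<omega>\<^sub>1\<^sup>2 - 3 * \<omega>\<^sub>2\<^sup>2 + 3) / (16 * (u * v))) = h20"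
    proof -
      have d: "\<omega>\<^sub>1\<^sup>2 - \<omega>\<^sub>2\<^sup>2 = u - v" by (simp add: xy)
      have E: "E1\<^sup>2 / (u * v) = \<omega>\<^sub>1\<^sup>2 * \<omega>\<^sub>2^4 * u / (\<delta>\<^sup>2 * (u - v)\<^sup>2 * v)"
        unfolding E1_def using nz
        by (simp add: power_divide power_mult_distrib flip: power_mult) (simp add: power2_eq_square mult_ac)
      have sp: "E1\<^sup>2 * (z / (16 * (u * v))) = E1\<^sup>2 / (u * v) * z / 16" for z
        by simp
      show ?thesis
        unfolding sp E unfolding assms(7) u_def[symmetric] v_def[symmetric] d by (simp add: mult_ac)
    qed
    finally show ?thesis by simp
  qed
  have h02: "h02 = k1 * c2\<^sup>2 * e2\<^sup>2 / 2 + 3 / 2 * (k2 * f2 * e2 ^ 3 + k3 * e2 ^ 4)"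
  proof -
    have "k1 * c2\<^sup>2 * e2\<^sup>2 / 2 + 3 / 2 * (k2 * f2 * e2 ^ 3 + k3 * e2 ^ 4) =
        e2 ^ 4 * (- (1 - \<beta>\<^sup>2) * \<alpha> * \<omega>\<^sub>2\<^sup>2 / 4 + 3 / 2 * (- \<beta>\<^sup>2 / (6 * v) + k3))"
      unfolding c kf by (simp add: algebra_simps power2_eq_square power3_eq_cube power4_eq_xxxx)
    also have "\<dots> = E2\<^sup>2 * ((4 * \<omega>\<^sub>2\<^sup>2 + 3 * (1 + \<delta>) * (v * u)) / (16 * (v * u)))"
    proof -
      have "\<alpha> = - 1 / (v * u)" "\<beta>\<^sup>2 = - \<delta> * v * u / (\<omega>\<^sub>2\<^sup>2 * \<omega>\<^sub>1\<^sup>2)"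
        unfolding \<alpha> \<beta> by (simp_all add: mult_ac)
      \<comment> \<open>The same identity with the two modes exchanged, which is why
        \<open>u * v\<close> was first reordered.\<close>
      from diagonal_coefficient_identity[OF xy(2,1) _ _ nz(4,3) this] show ?thesis
        unfolding k3_def pw using nz by simp
    qed
    also have "4 * \<omega>\<^sub>2\<^sup>2 + 3 * (1 + \<delta>) * (v * u) = 3 * \<delta> * u * v + 3 * v * \<omega>\<^sub>1\<^sup>2 + \<omega>\<^sub>2\<^sup>2 + 3"
      by (simp add: u_def v_def algebra_simps)
    also have "E2\<^sup>2 * ((3 * \<delta> * u * v + 3 * v * \<omega>\<^sub>1\<^sup>2 + \<omega>\<^sub>2\<^sup>2 + 3) / (16 * (v * u))) = h02"
    proof -
      have d: "\<omega>\<^sub>1\<^sup>2 - \<omega>\<^sub>2\<^sup>2 = u - v" by (simp add: xy)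
      have E: "E2\<^sup>2 / (v * u) = \<omega>\<^sub>1^4 * \<omega>\<^sub>2\<^sup>2 * v / (\<delta>\<^sup>2 * (u - v)\<^sup>2 * u)"
        unfolding E2_def using nz
        by (simp add: power_divide power_mult_distrib flip: power_mult) (simp add: power2_eq_square mult_ac)
      have sp: "E2\<^sup>2 * (z / (16 * (v * u))) = E2\<^sup>2 / (v * u) * z / 16" for z
        by simp
      show ?thesis
        unfolding sp E unfolding assms(9) u_def[symmetric] v_def[symmetric] d by (simp add: mult_ac)
    qed
    finally show ?thesis by simp
  qed
  have h11: "h11 = k1 * (c1\<^sup>2 * e2\<^sup>2 + c2\<^sup>2 * e1\<^sup>2) + 3 * k2 * (f1 * e1 * e2\<^sup>2 + f2 * e1\<^sup>2 * e2)
      + 6 * k3 * e1\<^sup>2 * e2\<^sup>2"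
  proof -
    have "k1 * (c1\<^sup>2 * e2\<^sup>2 + c2\<^sup>2 * e1\<^sup>2) + 3 * k2 * (f1 * e1 * e2\<^sup>2 + f2 * e1\<^sup>2 * e2) + 6 * k3 * e1\<^sup>2 * e2\<^sup>2 =
        (k1 * c1\<^sup>2) * e2\<^sup>2 + (k1 * c2\<^sup>2) * e1\<^sup>2 + 3 * ((k2 * f1) * e1 * e2\<^sup>2 + (k2 * f2) * e1\<^sup>2 * e2) + 6 * k3 * e1\<^sup>2 * e2\<^sup>2"
      by (simp add: algebra_simps)
    also have "\<dots> = e1\<^sup>2 * e2\<^sup>2 * (- (1 - \<beta>\<^sup>2) * \<alpha> * (\<omega>\<^sub>1\<^sup>2 + \<omega>\<^sub>2\<^sup>2) / 2 - \<beta>\<^sup>2 / 2 * (1 / u + 1 / v) + 6 * k3)"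
      unfolding c kf by (simp add: algebra_simps power2_eq_square add_divide_distrib diff_divide_distrib)
    also have "\<dots> = E1 * E2 * ((2 * (\<omega>\<^sub>1\<^sup>2 + \<omega>\<^sub>2\<^sup>2) + 3 * (1 + \<delta>) * (u * v)) / (4 * (u * v)))"
      unfolding k3_def e using mixed_coefficient_identity[OF xy _ _ nz(3,4) \<alpha> \<beta>] nz by simp
    also have "2 * (\<omega>\<^sub>1\<^sup>2 + \<omega>\<^sub>2\<^sup>2) + 3 * (1 + \<delta>) * (u * v) =
        - ((1 - 3 * \<omega>\<^sub>2\<^sup>2) * \<omega>\<^sub>1\<^sup>2 + \<omega>\<^sub>2\<^sup>2 - 3 - 3 * \<delta> * u * v)"
      by (simp add: u_def v_def algebra_simps)
    also have "E1 * E2 * (- ((1 - 3 * \<omega>\<^sub>2\<^sup>2) * \<omega>\<^sub>1\<^sup>2 + \<omega>\<^sub>2\<^sup>2 - 3 - 3 * \<delta> * u * v) / (4 * (u * v))) = h11"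
    proof -
      have d: "\<omega>\<^sub>1\<^sup>2 - \<omega>\<^sub>2\<^sup>2 = u - v" by (simp add: xy)
      \<comment> \<open>The product \<open>E1 * E2\<close> carries the factor
        \<open>- u * v\<close>, so the denominator of \<open>h11\<close> contains neither
        \<open>u\<close> nor \<open>v\<close>, in contrast to \<open>h20\<close> and
        \<open>h02\<close>; the minus sign absorbs the one in the rewritten numerator.\<close>
      have E: "E1 * E2 / (u * v) = - (\<omega>\<^sub>1^3 * \<omega>\<^sub>2^3) / (\<delta>\<^sup>2 * (u - v)\<^sup>2)"
        unfolding E1_def E2_def using nz by (simp add: power2_eq_square power3_eq_cube mult_ac)
      have sp: "E1 * E2 * (- z / (4 * (u * v))) = - (E1 * E2 / (u * v)) * z / 4" for z
        by simp
      show ?thesis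
        unfolding sp E unfolding assms(8) u_def[symmetric] v_def[symmetric] d by (simp add: mult_ac)
    qed
    finally show ?thesis by simp
  qed

  have N4: "removable \<omega>\<^sub>1 \<omega>\<^sub>2 (\<lambda>X. (h20 * (action1 X)\<^sup>2 + h11 * action1 X * action2 X + h02 * (action2 X)\<^sup>2)
      - hamiltonian_quartic \<alpha> \<beta> \<delta> (?L X))"
    using removable_even_quartic[OF nz(1,2) nonres h20 h11 h02]
    unfolding hamiltonian_quartic_def mode_map_nth k1_def k2_def k3_def .
  have "?L 0 = 0" by (simp add: vec_eq_iff forall_4 mode_map_nth)
  then show ?thesis
    by (intro birkhoff_normal_form_of_actions
        removable_imp_birkhoff_transformation[OF L _ mode_map_norm hamiltonian_expansion[OF assms(1,2)]
          K2 formlike_quartic_mode_map N4])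
qed

end
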